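(* Let $n\ge 0$, $d\ge 2$ be integers and let $S,T\in \mathrm{Sym}^d\mathbb{C}^{n+1}$. If $S\leq T$, then $\mathrm{sgr}(S)\leq \mathrm{sgr}(T)$.
   Context: For $T=(t_{i_1,\dots,i_d})\in \mathrm{Sym}^d\mathbb{C}^{n+1}$ (a symmetric tensor in $(\mathbb{C}^{n+1})^{\otimes d}$, coordinates with respect to the canonical basis $e_0,\dots,e_n$), the associated homogeneous degree $d$ polynomial is $F(x)=\sum t_{i_1,\dots,i_d}x_{i_1}\cdots x_{i_d}\in\mathbb{C}[x_0,\dots,x_n]_d$. The symmetric geometric rank is $\mathrm{sgr}(T)=\mathrm{codim}\{x\in\mathbb{C}^{n+1} : \frac{\partial F}{\partial x_0}(x)=\cdots=\frac{\partial F}{\partial x_n}(x)=0\}$ (codimension in $\mathbb{C}^{n+1}$); equivalently, it is the codimension in $\mathbb{P}^n$ of $\mathrm{Sing}(F)=\{[x]\in\mathbb{P}^n:\frac{\partial F}{\partial x_i}(x)=0\ \forall i\}$, with the convention that the empty set has codimension $n+1$ in $\mathbb{P}^n$. For $A\in M_{n+1}(\mathbb{C})$ (the $(n+1)\times(n+1)$ complex matrices, not necessarily invertible), $A\cdot T:=\sum_{i_1,\dots,i_d}t_{i_1,\dots,i_d}\,Ae_{i_1}\otimes\cdots\otimes Ae_{i_d}$. One writes $S\leq T$ if there exists $A\in M_{n+1}(\mathbb{C})$ with $S=A\cdot T$. *)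

theory Defs
  imports "HOL-Analysis.Analysis" "HOL-Library.Extended_Nat"
begin

section \<open>Tensors\<close>

text \<open>
  The space \<open>(C^(n+1))^(\<otimes>d)\<close> is rendered by coordinate arrays: \<^typ>\<open>'n\<close> is the index type
  of the canonical basis (so \<open>CARD('n) = n + 1\<close>), \<^typ>\<open>'d\<close> is the type of tensor positions
  (so \<open>CARD('d) = d\<close>), and a multi-index \<open>(i_1, \<dots>, i_d)\<close> is a function \<^typ>\<open>'d \<Rightarrow> 'n\<close>.
\<close>

type_synonym ('d, 'n) tensor = "complex ^ ('d \<Rightarrow> 'n)"

definition symmetric_tensors :: "('d::finite, 'n::finite) tensor set" where
  "symmetric_tensors = {T. \<forall>p i. bij p \<longrightarrow> T $ (i \<circ> p) = T $ i}"

definition pure_tensor :: "('d::finite \<Rightarrow> complex ^ 'n::finite) \<Rightarrow> ('d, 'n) tensor" where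
  "pure_tensor v = (\<chi> i. \<Prod>k\<in>UNIV. v k $ i k)"

definition tensor_act :: "complex ^ 'n ^ 'n \<Rightarrow> ('d::finite, 'n::finite) tensor \<Rightarrow> ('d, 'n) tensor" where
  "tensor_act A T = (\<Sum>i\<in>UNIV. T $ i *s pure_tensor (\<lambda>k. A *v axis (i k) 1))"

definition tensor_le :: "('d::finite, 'n::finite) tensor \<Rightarrow> ('d, 'n) tensor \<Rightarrow> bool"
    (infix "\<preceq>" 50) where
  "S \<preceq> T \<longleftrightarrow> (\<exists>A. S = tensor_act A T)"

text \<open>Over the infinite field of complex numbers a polynomial is identified with its function;
  its formal partial derivatives are then the complex partial derivatives.\<close>

definition assoc_poly :: "('d::finite, 'n::finite) tensor \<Rightarrow> complex ^ 'n \<Rightarrow> complex" where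
  "assoc_poly T x = (\<Sum>i\<in>UNIV. T $ i * (\<Prod>k\<in>UNIV. x $ i k))"

definition partial_deriv :: "'n::finite \<Rightarrow> (complex ^ 'n \<Rightarrow> complex) \<Rightarrow> complex ^ 'n \<Rightarrow> complex" where
  "partial_deriv j f x = deriv (\<lambda>z. f (x + axis j z)) 0"

section \<open>Zariski dimension\<close>

inductive polynomial_fun :: "(complex ^ 'n::finite \<Rightarrow> complex) \<Rightarrow> bool" where
  const: "polynomial_fun (\<lambda>x. c)"
| coord: "polynomial_fun (\<lambda>x. x $ i)"
| add: "polynomial_fun f \<Longrightarrow> polynomial_fun g \<Longrightarrow> polynomial_fun (\<lambda>x. f x + g x)"
| mult: "polynomial_fun f \<Longrightarrow> polynomial_fun g \<Longrightarrow> polynomial_fun (\<lambda>x. f x * g x)"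

definition zariski_closed :: "(complex ^ 'n::finite) set \<Rightarrow> bool" where
  "zariski_closed X \<longleftrightarrow> (\<exists>P. (\<forall>f\<in>P. polynomial_fun f) \<and> X = {x. \<forall>f\<in>P. f x = 0})"

definition zariski_irreducible :: "(complex ^ 'n::finite) set \<Rightarrow> bool" where
  "zariski_irreducible Z \<longleftrightarrow> Z \<noteq> {} \<and>
    (\<forall>X Y. zariski_closed X \<longrightarrow> zariski_closed Y \<longrightarrow> Z \<subseteq> X \<union> Y \<longrightarrow> Z \<subseteq> X \<or> Z \<subseteq> Y)"

text \<open>The Krull dimension of a Zariski closed set: the supremum of the lengths \<open>k\<close> of chains
  \<open>Z 0 \<subset> \<dots> \<subset> Z k\<close> of irreducible closed subsets. As a supremum in \<^typ>\<open>enat\<close>, it is 0 for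
  the empty set.\<close>

definition krull_dim :: "(complex ^ 'n::finite) set \<Rightarrow> enat" where
  "krull_dim X = Sup {enat k | k. \<exists>Z.
     (\<forall>i\<le>k. zariski_closed (Z i) \<and> zariski_irreducible (Z i) \<and> Z i \<subseteq> X) \<and>
     (\<forall>i<k. Z i \<subset> Z (Suc i))}"

definition codim :: "(complex ^ 'n::finite) set \<Rightarrow> enat" where
  "codim X = enat CARD('n) - krull_dim X"

section \<open>Symmetric geometric rank\<close>

text \<open>For \<open>d \<ge> 2\<close> the singular locus in affine space contains the origin, so the value of
  \<^const>\<open>krull_dim\<close> on the empty set plays no role.\<close>

definition sing_locus :: "('d::finite, 'n::finite) tensor \<Rightarrow> (complex ^ 'n) set" where
  "sing_locus T = {x. \<forall>j. partial_deriv j (assoc_poly T) x = 0}"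

definition sgr :: "('d::finite, 'n::finite) tensor \<Rightarrow> enat" where
  "sgr T = codim (sing_locus T)"

end

theory Submission
  imports Defs "Jordan_Normal_Form.Char_Poly"
begin

(* Both names would otherwise be ambiguous between two theories of vectors, or of scalar multiples. *)
no_notation Matrix.vec_index (infixl "$" 100)
hide_const (open) Module.smult

text \<open>
  If \<open>S = A \<cdot> T\<close>, then the polynomials are related by \<open>F_S (x) = F_T (B x)\<close>, where \<open>B\<close> is the transpose of
  \<open>A\<close>. By the chain rule the singular locus of \<open>F_S\<close> contains the preimage under \<open>B\<close> of the singular
  locus \<open>X\<close> of \<open>F_T\<close> (\<open>sing_locus_tensor_act\<close>). So it suffices that the preimage of \<open>X\<close> under
  any linear endomorphism, invertible or not, has at least the dimension of \<open>X\<close>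
  (\<open>krull_dim_cone_vimage\<close>). This fails for general closed sets, whose preimage may even be empty; but
  \<open>X\<close> is a cone, the partial derivatives being homogeneous of positive degree.

  For a closed cone \<open>X\<close> in \<open>C^N\<close> the dimension equals \<open>N - m\<close>, where \<open>m\<close> is the greatest dimension of
  a linear subspace \<open>L\<close> with \<open>X \<inter> L = {0}\<close>. The two inequalities are \<open>krull_dim_le_codim\<close> and
  \<open>exists_complement_krull_dim_ge\<close>. From this description the claim is immediate: if \<open>L\<close> meets the preimage
  of \<open>X\<close> only in \<open>0\<close>, then it meets the kernel of \<open>B\<close> only in \<open>0\<close>, so the image of \<open>L\<close> under \<open>B\<close> has the
  same dimension as \<open>L\<close>, and it meets \<open>X\<close> only in \<open>0\<close>.

  The description of the dimension rests on linear projections. If \<open>X \<inter> L = {0}\<close>, the projection along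
  \<open>L\<close> is finite on \<open>X\<close>: a form that vanishes on a cone but not at \<open>p\<close> is a monic equation in the direction
  \<open>p\<close>. Instead of changing the ambient space, images are represented by the cylinders \<open>Z + L\<close> over
  closed subsets \<open>Z\<close> of \<open>X\<close>. These are closed, and proper inclusions below irreducible sets stay proper
  (\<open>zariski_closed_plus_subspace\<close>, \<open>incomparability_along_subspace\<close>); both facts come from the
  characteristic polynomial of multiplication by a function (\<open>integral_equation\<close>). Hence a chain in \<open>X\<close>
  yields a chain of \<open>L\<close>-invariant sets, whose length is at most the codimension of \<open>L\<close>
  (\<open>invariant_chain_length\<close>). Conversely, when \<open>L\<close> is maximal the cylinder over \<open>X\<close> is the whole space,
  and a flag of subspaces above \<open>L\<close> lifts to a chain in \<open>X\<close> (\<open>lift_chain\<close>).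
\<close>

section \<open>Polynomial functions and their restrictions to lines\<close>

lemma polynomial_fun_uminus:
  assumes "polynomial_fun f" shows "polynomial_fun (\<lambda>x. - f x)"
  using polynomial_fun.mult[OF polynomial_fun.const[of "-1"] assms] by simp

lemma polynomial_fun_sum:
  assumes "\<And>i. i \<in> I \<Longrightarrow> polynomial_fun (f i)"
  shows "polynomial_fun (\<lambda>x. \<Sum>i\<in>I. f i x)"
  using assms
  by (induction I rule: infinite_finite_induct) (auto intro: polynomial_fun.intros)

lemma polynomial_fun_prod:
  assumes "\<And>i. i \<in> I \<Longrightarrow> polynomial_fun (f i)"
  shows "polynomial_fun (\<lambda>x. \<Prod>i\<in>I. f i x)"
  using assms
  by (induction I rule: infinite_finite_induct) (auto intro: polynomial_fun.intros)

lemma polynomial_fun_compose: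
  assumes "polynomial_fun f" and "\<And>i. polynomial_fun (\<lambda>x. h x $ i)"
  shows "polynomial_fun (\<lambda>x. f (h x))"
  using assms by (induction f) (auto intro: polynomial_fun.intros)

lemma continuous_on_polynomial_fun:
  assumes "polynomial_fun f" shows "continuous_on A f"
  using assms by (induction f) (auto intro!: continuous_intros)

text \<open>
  An inductive description, because the expansion along a line is proved by following how the
  form is built. The zero form is admitted in every degree, so that the graded pieces of a
  polynomial can be listed without gaps.
\<close>

inductive homogeneous_poly :: "nat \<Rightarrow> (complex ^ 'n::finite \<Rightarrow> complex) \<Rightarrow> bool" where
  zero: "homogeneous_poly d (\<lambda>x. 0)"
| const: "homogeneous_poly 0 (\<lambda>x. c)"
| coord: "homogeneous_poly 1 (\<lambda>x. x $ i)"
| add: "homogeneous_poly d f \<Longrightarrow> homogeneous_poly d g \<Longrightarrow> homogeneous_poly d (\<lambda>x. f x + g x)"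
| mult: "homogeneous_poly d f \<Longrightarrow> homogeneous_poly e g \<Longrightarrow>
    homogeneous_poly (d + e) (\<lambda>x. f x * g x)"

lemma homogeneous_poly_sum:
  assumes "\<And>i. i \<in> I \<Longrightarrow> homogeneous_poly d (f i)"
  shows "homogeneous_poly d (\<lambda>x. \<Sum>i\<in>I. f i x)"
  using assms
  by (induction I rule: infinite_finite_induct) (auto intro: homogeneous_poly.intros)

text \<open>
  Univariate polynomials over the ring of polynomial functions, in evaluated form: this is how
  a polynomial in \<open>n\<close> variables is split into a distinguished variable and parameters.
\<close>

definition polynomial_coeffs :: "(complex ^ 'n::finite \<Rightarrow> complex poly) \<Rightarrow> bool" where
  "polynomial_coeffs P \<longleftrightarrow> (\<forall>i. polynomial_fun (\<lambda>x. coeff (P x) i))"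

lemma polynomial_coeffs_const: "polynomial_coeffs (\<lambda>x. q)"
  by (simp add: polynomial_coeffs_def polynomial_fun.const)

lemma polynomial_coeffs_pCons:
  "polynomial_fun f \<Longrightarrow> polynomial_coeffs P \<Longrightarrow> polynomial_coeffs (\<lambda>x. pCons (f x) (P x))"
  unfolding polynomial_coeffs_def
proof
  fix i assume "polynomial_fun f" and "\<forall>i. polynomial_fun (\<lambda>x. coeff (P x) i)"
  then show "polynomial_fun (\<lambda>x. coeff (pCons (f x) (P x)) i)" by (cases i) auto
qed

lemma polynomial_coeffs_add:
  "polynomial_coeffs P \<Longrightarrow> polynomial_coeffs Q \<Longrightarrow> polynomial_coeffs (\<lambda>x. P x + Q x)"
  by (simp add: polynomial_coeffs_def polynomial_fun.add)

lemma polynomial_coeffs_mult: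
  "polynomial_coeffs P \<Longrightarrow> polynomial_coeffs Q \<Longrightarrow> polynomial_coeffs (\<lambda>x. P x * Q x)"
  by (auto simp: polynomial_coeffs_def coeff_mult intro!: polynomial_fun_sum polynomial_fun.mult)

lemma polynomial_coeffs_smult:
  "polynomial_fun f \<Longrightarrow> polynomial_coeffs P \<Longrightarrow> polynomial_coeffs (\<lambda>x. smult (f x) (P x))"
  by (simp add: polynomial_coeffs_def polynomial_fun.mult)

lemma polynomial_coeffs_diff:
  "polynomial_coeffs P \<Longrightarrow> polynomial_coeffs Q \<Longrightarrow> polynomial_coeffs (\<lambda>x. P x - Q x)"
  using polynomial_coeffs_add[OF _ polynomial_coeffs_smult[OF polynomial_fun.const[of "-1"]], of P Q]
  by simp

lemma polynomial_coeffs_sum: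
  assumes "\<And>i. i \<in> I \<Longrightarrow> polynomial_coeffs (P i)"
  shows "polynomial_coeffs (\<lambda>x. \<Sum>i\<in>I. P i x)"
  using assms
  by (induction I rule: infinite_finite_induct)
    (auto intro: polynomial_coeffs_const polynomial_coeffs_add)

lemma polynomial_coeffs_prod:
  assumes "\<And>i. i \<in> I \<Longrightarrow> polynomial_coeffs (P i)"
  shows "polynomial_coeffs (\<lambda>x. \<Prod>i\<in>I. P i x)"
  using assms
  by (induction I rule: infinite_finite_induct)
    (auto intro: polynomial_coeffs_const polynomial_coeffs_mult)

lemma polynomial_coeffs_compose:
  assumes "polynomial_coeffs P" and "\<And>i. polynomial_fun (\<lambda>x. h x $ i)"
  shows "polynomial_coeffs (\<lambda>x. P (h x))"
  using assms polynomial_fun_compose[of "\<lambda>x. coeff (P x) _"] by (auto simp: polynomial_coeffs_def)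

lemma poly_eq_sum_degree_le:
  fixes P :: "'a :: comm_semiring_1 poly"
  assumes "degree P \<le> m"
  shows "poly P x = (\<Sum>i\<le>m. coeff P i * x ^ i)"
  unfolding Polynomial.poly_altdef
  by (rule sum.mono_neutral_left) (use assms in \<open>auto simp: coeff_eq_0\<close>)

lemma polynomial_fun_poly:
  assumes "polynomial_coeffs P" and "polynomial_fun f" and "\<And>x. degree (P x) \<le> m"
  shows "polynomial_fun (\<lambda>x. poly (P x) (f x))"
proof -
  have "poly (P x) (f x) = (\<Sum>i\<le>m. coeff (P x) i * (\<Prod>_<i. f x))" for x
    using poly_eq_sum_degree_le[OF assms(3)] by simp
  then show ?thesis
    using assms by (auto simp: polynomial_coeffs_def 
        intro!: polynomial_fun_sum polynomial_fun.mult polynomial_fun_prod simp del: prod_constant)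
qed

lemma coeff_mult_degree_le:
  assumes "degree P \<le> d" and "degree Q \<le> e"
  shows "coeff (P * Q) (d + e) = coeff P d * coeff (Q :: 'a :: comm_semiring_0 poly) e"
proof -
  have "coeff (P * Q) (d + e) = (\<Sum>i\<le>d + e. coeff P i * coeff Q (d + e - i))"
    by (simp add: coeff_mult)
  also have "\<dots> = (\<Sum>i\<in>{d}. coeff P i * coeff Q (d + e - i))"
  proof (rule sum.mono_neutral_right)
    show "\<forall>i\<in>{..d + e} - {d}. coeff P i * coeff Q (d + e - i) = 0"
    proof
      fix i assume "i \<in> {..d + e} - {d}"
      then consider "i > d" | "d + e - i > e" by fastforce
      then show "coeff P i * coeff Q (d + e - i) = 0"
        using assms by cases (simp_all add: coeff_eq_0)
    qed
  qed auto
  finally show ?thesis by simp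
qed

text \<open>
  The coefficient of \<open>t ^ d\<close> in \<open>f (x + t p)\<close> is the constant \<open>f p\<close>. So a form that does not
  vanish at \<open>p\<close> becomes, up to a scalar, monic in the direction \<open>p\<close>.
\<close>

lemma homogeneous_poly_expand_along:
  assumes "homogeneous_poly d f"
  shows "\<exists>G. polynomial_coeffs G \<and> (\<forall>x. degree (G x) \<le> d \<and> coeff (G x) d = f p) \<and>
    (\<forall>x t. f (x + t *s p) = poly (G x) t)"
  using assms
proof (induction rule: homogeneous_poly.induct)
  case (zero d)
  show ?case by (intro exI[of _ "\<lambda>_. 0"]) (auto intro: polynomial_coeffs_const)
next
  case (const c)
  show ?case by (intro exI[of _ "\<lambda>_. [:c:]"]) (auto intro: polynomial_coeffs_const)
next
  case (coord i)
  show ?case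
    by (intro exI[of _ "\<lambda>x. [:x $ i, p $ i:]"])
      (auto intro!: polynomial_coeffs_const polynomial_coeffs_pCons polynomial_fun.intros)
next
  case (add d f g)
  then obtain F G where
    "polynomial_coeffs F" "\<forall>x. degree (F x) \<le> d \<and> coeff (F x) d = f p"
    "\<forall>x t. f (x + t *s p) = poly (F x) t"
    "polynomial_coeffs G" "\<forall>x. degree (G x) \<le> d \<and> coeff (G x) d = g p"
    "\<forall>x t. g (x + t *s p) = poly (G x) t" by blast
  then show ?case
    by (intro exI[of _ "\<lambda>x. F x + G x"]) (auto intro: polynomial_coeffs_add degree_add_le)
next
  case (mult d f e g)
  then obtain F G where
    "polynomial_coeffs F" "\<forall>x. degree (F x) \<le> d \<and> coeff (F x) d = f p"
    "\<forall>x t. f (x + t *s p) = poly (F x) t"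
    "polynomial_coeffs G" "\<forall>x. degree (G x) \<le> e \<and> coeff (G x) e = g p"
    "\<forall>x t. g (x + t *s p) = poly (G x) t" by blast
  then show ?case
    by (intro exI[of _ "\<lambda>x. F x * G x"])
      (auto intro!: polynomial_coeffs_mult order_trans[OF degree_mult_le] add_mono
        simp: coeff_mult_degree_le)
qed

lemma homogeneous_sum_expand_along:
  assumes "\<And>i. i \<le> m \<Longrightarrow> homogeneous_poly i (F i)"
  shows "\<exists>G. polynomial_coeffs G \<and> (\<forall>x. degree (G x) \<le> m \<and> coeff (G x) m = F m p) \<and>
    (\<forall>x t. (\<Sum>i\<le>m. F i (x + t *s p)) = poly (G x) t)"
proof -
  from assms have "\<forall>i\<in>{..m}. \<exists>G. polynomial_coeffs G \<and> (\<forall>x. degree (G x) \<le> i \<and> coeff (G x) i = F i p) \<and>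
    (\<forall>x t. F i (x + t *s p) = poly (G x) t)"
    using homogeneous_poly_expand_along by blast
  then obtain G where G: "\<And>i. i \<le> m \<Longrightarrow> polynomial_coeffs (G i)"
    "\<And>i x. i \<le> m \<Longrightarrow> degree (G i x) \<le> i" "\<And>i x. i \<le> m \<Longrightarrow> coeff (G i x) i = F i p"
    "\<And>i x t. i \<le> m \<Longrightarrow> F i (x + t *s p) = poly (G i x) t"
    by (fastforce dest!: bchoice)
  have "coeff (\<Sum>i\<le>m. G i x) m = F m p" for x
  proof -
    have "coeff (\<Sum>i\<le>m. G i x) m = (\<Sum>i\<le>m. coeff (G i x) m)" by (simp add: coeff_sum)
    also have "\<dots> = (\<Sum>i\<in>{m}. coeff (G i x) m)"
    proof (rule sum.mono_neutral_right)
      show "\<forall>i\<in>{..m} - {m}. coeff (G i x) m = 0"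
        using G(2)[of _ x] by (fastforce intro!: coeff_eq_0)
    qed auto
    finally show ?thesis using G(3) by simp
  qed
  then show ?thesis using G
    by (intro exI[of _ "\<lambda>x. \<Sum>i\<le>m. G i x"])
      (auto simp: poly_sum intro!: polynomial_coeffs_sum degree_sum_le order_trans[OF G(2)])
qed

text \<open>
  The homogeneous parts of \<open>f\<close> are collected as the coefficients of one polynomial in the scaling
  parameter \<open>s\<close>; multiplication of polynomials in \<open>s\<close> then takes care of the convolution of the
  parts.
\<close>

lemma polynomial_fun_graded:
  assumes "polynomial_fun f"
  shows "\<exists>H m. (\<forall>i. homogeneous_poly i (\<lambda>x. coeff (H x) i)) \<and> (\<forall>x. degree (H x) \<le> m) \<and>
    (\<forall>x s. f (s *s x) = poly (H x) s)"
  using assms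
proof (induction rule: polynomial_fun.induct)
  case (const c)
  have "homogeneous_poly i (\<lambda>x::complex^'a. coeff [:c:] i)" for i
    by (cases i) (auto intro: homogeneous_poly.intros)
  then show ?case by (intro exI[of _ "\<lambda>_. [:c:]"] exI[of _ 0]) auto
next
  case (coord j)
  have "homogeneous_poly i (\<lambda>x::complex^'a. coeff [:0, x $ j:] i)" for i
    using homogeneous_poly.coord[of j]
    by (cases i rule: list_decode.cases; cases "i - 1")
       (auto intro: homogeneous_poly.intros simp: coeff_pCons split: nat.splits)
  then show ?case by (intro exI[of _ "\<lambda>x. [:0, x $ j:]"] exI[of _ 1]) auto
next
  case (add f g)
  then obtain F G m n where
    "\<forall>i. homogeneous_poly i (\<lambda>x. coeff (F x) i)" "\<forall>x. degree (F x) \<le> m"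
    "\<forall>x s. f (s *s x) = poly (F x) s"
    "\<forall>i. homogeneous_poly i (\<lambda>x. coeff (G x) i)" "\<forall>x. degree (G x) \<le> n"
    "\<forall>x s. g (s *s x) = poly (G x) s" by metis
  then show ?case
    by (intro exI[of _ "\<lambda>x. F x + G x"] exI[of _ "max m n"])
      (auto intro!: homogeneous_poly.add degree_add_le intro: max.coboundedI1 max.coboundedI2)
next
  case (mult f g)
  then obtain F G m n where FG:
    "\<forall>i. homogeneous_poly i (\<lambda>x. coeff (F x) i)" "\<forall>x. degree (F x) \<le> m"
    "\<forall>x s. f (s *s x) = poly (F x) s"
    "\<forall>i. homogeneous_poly i (\<lambda>x. coeff (G x) i)" "\<forall>x. degree (G x) \<le> n"
    "\<forall>x s. g (s *s x) = poly (G x) s" by metis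
  have "homogeneous_poly i (\<lambda>x. coeff (F x) j * coeff (G x) (i - j))" if "j \<le> i" for i j
    using homogeneous_poly.mult[of j "\<lambda>x. coeff (F x) j" "i - j" "\<lambda>x. coeff (G x) (i - j)"] FG that
    by simp
  then have "homogeneous_poly i (\<lambda>x. coeff (F x * G x) i)" for i
    by (auto simp: coeff_mult intro!: homogeneous_poly_sum)
  then show ?case using FG
    by (intro exI[of _ "\<lambda>x. F x * G x"] exI[of _ "m + n"])
      (auto intro!: order_trans[OF degree_mult_le] add_mono)
qed

lemma polynomial_fun_expand_along:
  assumes "polynomial_fun f"
  shows "\<exists>G m. polynomial_coeffs G \<and> (\<forall>x. degree (G x) \<le> m) \<and>
    (\<forall>x t. f (x + t *s p) = poly (G x) t)"
proof -
  obtain H m where H: "\<forall>i. homogeneous_poly i (\<lambda>x. coeff (H x) i)" "\<And>x. degree (H x) \<le> m"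
    "\<forall>x s. f (s *s x) = poly (H x) s"
    using polynomial_fun_graded[OF assms] by blast
  have "f x = (\<Sum>i\<le>m. coeff (H x) i)" for x
    using H(3)[rule_format, of 1 x] poly_eq_sum_degree_le[OF H(2), of x 1] by simp
  with homogeneous_sum_expand_along[of m "\<lambda>i x. coeff (H x) i" p] H(1) show ?thesis
    by (simp, meson)
qed

text \<open>
  Division by a monic polynomial never divides by a parameter, so the remainder is again
  polynomial in the parameters.
\<close>

lemma polynomial_coeffs_mod:
  assumes "polynomial_coeffs P" and "\<And>x. degree (P x) \<le> m"
    and Q: "polynomial_coeffs Q" "\<And>x. degree (Q x) = D" "\<And>x. lead_coeff (Q x) = 1"
  shows "polynomial_coeffs (\<lambda>x. P x mod Q x)"
  using assms(1,2)
proof (induction m arbitrary: P rule: less_induct)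
  case (less m)
  show ?case
  proof (cases "m < D")
    case True
    then have "P x mod Q x = P x" for x
      using less.prems(2)[of x] Q(2)[of x] by (intro mod_poly_less) simp
    then show ?thesis using less.prems by simp
  next
    case False
    \<comment> \<open>cancel the coefficient of \<open>t ^ m\<close>\<close>
    define R where "R x = P x - smult (coeff (P x) m) (monom 1 (m - D) * Q x)" for x
    have R: "polynomial_coeffs R"
      unfolding R_def using less.prems Q
      by (intro polynomial_coeffs_diff polynomial_coeffs_smult polynomial_coeffs_mult
          polynomial_coeffs_const) (auto simp: polynomial_coeffs_def)
    have mod: "R x mod Q x = P x mod Q x" for x
      by (simp add: R_def poly_mod_diff_left mod_smult_left)
    have deg: "degree (R x) \<le> m" "coeff (R x) m = 0" for x
    proof -
      have 1: "degree (monom 1 (m - D) * Q x) \<le> m"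
        using degree_mult_le[of "monom 1 (m - D)" "Q x"] degree_monom_le[of "1::complex" "m - D"] Q False
        by (smt (verit, best) le_add_diff_inverse2 nat_add_left_cancel_le not_less order_trans add.commute)
      then show "degree (R x) \<le> m" unfolding R_def
        using less.prems(2)[of x] by (intro degree_diff_le) (auto intro: order_trans[OF degree_smult_le])
      have "coeff (monom 1 (m - D) * Q x) m = 1"
        using Q(2,3)[of x] False by (simp add: coeff_monom_mult)
      then show "coeff (R x) m = 0" by (simp add: R_def)
    qed
    show ?thesis
    proof (cases m)
      case 0
      then have "R x = 0" for x using deg[of x] by (metis le_zero_eq leading_coeff_0_iff)
      then have "P x mod Q x = 0" for x using mod[of x] by simp
      then show ?thesis by (simp add: polynomial_coeffs_const)
    next
      case (Suc k)
      have "degree (R x) \<le> k" for x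
        using deg[of x] Suc by (metis coeff_0 degree_0 eq_zero_or_degree_less le_SucE le_neq_implies_less leading_coeff_0_iff le_zero_eq zero_le)
      then have "polynomial_coeffs (\<lambda>x. R x mod Q x)"
        using less.IH[of k R] R Suc by simp
      then show ?thesis by (simp add: mod)
    qed
  qed
qed

section \<open>Zariski closed and irreducible sets\<close>

lemma zariski_closed_zeros:
  "polynomial_fun f \<Longrightarrow> zariski_closed {x. f x = 0}"
  unfolding zariski_closed_def by (intro exI[of _ "{f}"]) auto

lemma zariski_closed_separate:
  assumes "zariski_closed X" and "x \<notin> X"
  obtains f where "polynomial_fun f" "\<And>z. z \<in> X \<Longrightarrow> f z = 0" "f x \<noteq> 0"
  using assms unfolding zariski_closed_def by blast

lemma zariski_closedI:
  assumes "\<And>x. x \<notin> X \<Longrightarrow> \<exists>f. polynomial_fun f \<and> (\<forall>z\<in>X. f z = 0) \<and> f x \<noteq> 0"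
  shows "zariski_closed X"
  unfolding zariski_closed_def
  by (rule exI[of _ "{f. polynomial_fun f \<and> (\<forall>z\<in>X. f z = 0)}"]) (use assms in blast)

lemma zariski_closed_Inter:
  assumes "\<And>X. X \<in> \<X> \<Longrightarrow> zariski_closed X"
  shows "zariski_closed (\<Inter>\<X>)"
proof (rule zariski_closedI)
  fix x assume "x \<notin> \<Inter>\<X>"
  then obtain X where X: "X \<in> \<X>" "x \<notin> X" by auto
  obtain f where "polynomial_fun f" "\<And>z. z \<in> X \<Longrightarrow> f z = 0" "f x \<noteq> 0"
    using zariski_closed_separate[OF assms[OF X(1)] X(2)] by metis
  with X(1) show "\<exists>f. polynomial_fun f \<and> (\<forall>z\<in>\<Inter>\<X>. f z = 0) \<and> f x \<noteq> 0" by blast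
qed

lemma zariski_closed_Int:
  "zariski_closed X \<Longrightarrow> zariski_closed Y \<Longrightarrow> zariski_closed (X \<inter> Y)"
  using zariski_closed_Inter[of "{X, Y}"] by auto

lemma zariski_closed_vimage:
  assumes "zariski_closed X" and "\<And>i. polynomial_fun (\<lambda>x. h x $ i)"
  shows "zariski_closed (h -` X)"
proof (rule zariski_closedI)
  fix x assume "x \<notin> h -` X"
  then obtain f where f: "polynomial_fun f" "\<And>z. z \<in> X \<Longrightarrow> f z = 0" "f (h x) \<noteq> 0"
    using zariski_closed_separate[OF assms(1), of "h x"] by auto
  then show "\<exists>f. polynomial_fun f \<and> (\<forall>z\<in>h -` X. f z = 0) \<and> f x \<noteq> 0"
    by (intro exI[of _ "\<lambda>x. f (h x)"]) (simp add: polynomial_fun_compose[OF f(1) assms(2)])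
qed

lemma polynomial_fun_affine: "polynomial_fun (\<lambda>x. (x + v) $ i)"
  by (auto intro: polynomial_fun.intros)

lemma zariski_closed_imp_closed:
  assumes "zariski_closed X" shows "closed X"
proof -
  obtain P where P: "\<forall>f\<in>P. polynomial_fun f" "X = {x. \<forall>f\<in>P. f x = 0}"
    using assms unfolding zariski_closed_def by blast
  have "X = (\<Inter>f\<in>P. {x. f x = 0})" using P(2) by auto
  moreover have "closed {x. f x = 0}" if "f \<in> P" for f
    using continuous_on_polynomial_fun[of f UNIV] P(1) that
    by (intro closed_Collect_eq) auto
  ultimately show ?thesis by auto
qed

text \<open>
  The coordinate ring of an irreducible set is an integral domain.
\<close>

lemma zariski_irreducible_mult_eq_0:
  assumes "zariski_irreducible Z" "polynomial_fun f" "polynomial_fun g" "\<And>z. z \<in> Z \<Longrightarrow> f z * g z = 0"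
  shows "(\<forall>z\<in>Z. f z = 0) \<or> (\<forall>z\<in>Z. g z = 0)"
proof -
  have "Z \<subseteq> {x. f x = 0} \<union> {x. g x = 0}" using assms(4) by auto
  then have "Z \<subseteq> {x. f x = 0} \<or> Z \<subseteq> {x. g x = 0}"
    using assms(1) zariski_closed_zeros[OF assms(2)] zariski_closed_zeros[OF assms(3)]
    unfolding zariski_irreducible_def by blast
  then show ?thesis by auto
qed

section \<open>Finite projections along a line\<close>

lemma polynomial_coeffs_char_poly:
  assumes "\<And>x. A x \<in> carrier_mat D D"
    and "\<And>a b. a < D \<Longrightarrow> b < D \<Longrightarrow> polynomial_fun (\<lambda>x. A x $$ (a, b))"
  shows "polynomial_coeffs (\<lambda>x. char_poly (A x))"
proof -
  have dim: "dim_row (A x) = D" "dim_col (A x) = D" for x using assms(1)[of x] by auto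
  have entry: "polynomial_coeffs (\<lambda>x. char_poly_matrix (A x) $$ (a, b))" if "a < D" "b < D" for a b
  proof -
    have "char_poly_matrix (A x) $$ (a, b) = (if a = b then [:0, 1:] else 0) + [:- (A x $$ (a, b)):]" for x
      using that by (auto simp: char_poly_matrix_def dim)
    then show ?thesis
      using polynomial_coeffs_add[OF polynomial_coeffs_const polynomial_coeffs_pCons[OF
            polynomial_fun_uminus[OF assms(2)[OF that]] polynomial_coeffs_const]]
      by simp
  qed
  have "char_poly (A x) = (\<Sum>p | p permutes {0..<D}.
      signof p * (\<Prod>i = 0..<D. char_poly_matrix (A x) $$ (i, p i)))" for x
    unfolding char_poly_def by (rule det_def') (simp add: assms(1))
  moreover have "polynomial_coeffs (\<lambda>x. \<Prod>i = 0..<D. char_poly_matrix (A x) $$ (i, p i))"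
    if "p permutes {0..<D}" for p
  proof (rule polynomial_coeffs_prod, rule entry)
    fix i assume "i \<in> {0..<D}"
    then show "i < D" "p i < D" using permutes_in_image[OF that, of i] by auto
  qed
  ultimately show ?thesis
    by (simp, intro polynomial_coeffs_sum polynomial_coeffs_mult[OF polynomial_coeffs_const]) simp
qed

text \<open>
  The \<open>p\<close>-coordinate is integral over the functions that are constant along \<open>p\<close>: on \<open>X\<close> it
  satisfies a monic equation. Geometrically, the linear projection with kernel spanned by \<open>p\<close>
  is finite on \<open>X\<close>.
\<close>

definition integral_along :: "complex ^ 'n::finite \<Rightarrow> (complex ^ 'n) set \<Rightarrow> bool" where
  "integral_along p X \<longleftrightarrow> (\<exists>Q D. polynomial_coeffs Q \<and> (\<forall>x. degree (Q x) = D \<and> lead_coeff (Q x) = 1) \<and>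
    (\<forall>x t. x + t *s p \<in> X \<longrightarrow> poly (Q x) t = 0))"

lemma integral_alongI:
  assumes G: "polynomial_coeffs G" "\<And>x. degree (G x) \<le> d" "\<And>x. coeff (G x) d = c"
    and "c \<noteq> 0" "\<And>x t. x + t *s p \<in> X \<Longrightarrow> poly (G x) t = 0"
  shows "integral_along p X"
proof -
  define Q where "Q x = smult (inverse c) (G x)" for x
  have Q: "degree (Q x) = d" "coeff (Q x) d = 1" for x
  proof -
    show "coeff (Q x) d = 1" using assms(4) by (simp add: Q_def G(3))
    moreover have "degree (Q x) \<le> d"
      using G(2)[of x] unfolding Q_def by (meson degree_smult_le order_trans)
    ultimately show "degree (Q x) = d" by (metis le_antisym le_degree zero_neq_one)
  qed
  moreover have "polynomial_coeffs Q"
    unfolding Q_def by (intro polynomial_coeffs_smult polynomial_fun.const G(1))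
  moreover have "poly (Q x) t = 0" if "x + t *s p \<in> X" for x t
    using assms(5)[OF that] by (simp add: Q_def)
  ultimately show ?thesis
    unfolding integral_along_def by (intro exI[of _ Q] exI[of _ d]) auto
qed

lemma obtain_coordinate_along:
  fixes p :: "complex ^ 'n::finite"
  assumes "p \<noteq> 0"
  obtains \<phi> where "polynomial_fun \<phi>" "\<And>x t. \<phi> (x + t *s p) = \<phi> x + t" "\<And>x. polynomial_fun (\<lambda>y. \<phi> (y - x))"
proof -
  obtain i where i: "p $ i \<noteq> 0" using assms by (auto simp: Finite_Cartesian_Product.vec_eq_iff)
  show thesis
  proof
    show "polynomial_fun (\<lambda>x. inverse (p $ i) * x $ i)" by (auto intro: polynomial_fun.intros)
    show "inverse (p $ i) * (x + t *s p) $ i = inverse (p $ i) * x $ i + t" for x t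
      using i by (simp add: field_simps)
    show "polynomial_fun (\<lambda>y. inverse (p $ i) * (y - x) $ i)" for x
      using polynomial_fun.mult[OF polynomial_fun.const polynomial_fun_affine[of "-x" i]] by simp
  qed
qed

text \<open>
  Every polynomial function \<open>g\<close>, not only the \<open>p\<close>-coordinate, satisfies on \<open>X\<close> a monic equation whose
  coefficients are constant along \<open>p\<close>: take the characteristic polynomial \<open>K\<close> of multiplication by
  \<open>g\<close> on the free module \<open>C[t] / (Q)\<close>. Over a point of \<open>X\<close> the value of \<open>g\<close> is an eigenvalue, because
  evaluation at a root of \<open>Q\<close> is an eigenvector (of the transposed operator). Where \<open>g\<close> is \<open>1\<close> on the whole
  line the operator is the identity; hence the constant term of \<open>K\<close>, the norm of \<open>g\<close> up to sign,
  does not vanish there.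
\<close>

lemma integral_equation:
  fixes p :: "complex ^ 'n::finite"
  assumes p: "p \<noteq> 0" and X: "integral_along p X" and g: "polynomial_fun g"
  shows "\<exists>K D. polynomial_coeffs K \<and> (\<forall>x t. K (x + t *s p) = K x) \<and>
    (\<forall>x. degree (K x) = D \<and> lead_coeff (K x) = 1) \<and> (\<forall>x\<in>X. poly (K x) (g x) = 0) \<and>
    (\<forall>x. (\<forall>t. g (x + t *s p) = 1) \<longrightarrow> poly (K x) 0 \<noteq> 0)"
proof -
  obtain Q D where Q: "polynomial_coeffs Q" "\<And>x. degree (Q x) = D" "\<And>x. lead_coeff (Q x) = 1"
    and QX: "\<And>x t. x + t *s p \<in> X \<Longrightarrow> poly (Q x) t = 0"
    using X unfolding integral_along_def by blast
  obtain G m where G: "polynomial_coeffs G" "\<And>x. degree (G x) \<le> m" "\<And>x t. g (x + t *s p) = poly (G x) t"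
    using polynomial_fun_expand_along[OF g] by metis
  obtain \<phi> where \<phi>: "polynomial_fun \<phi>" "\<And>x t. \<phi> (x + t *s p) = \<phi> x + t"
    using obtain_coordinate_along[OF p] by metis
  \<comment> \<open>the linear projection along \<open>p\<close>; composing with it makes everything constant along \<open>p\<close>\<close>
  define \<pi> where "\<pi> x = x + (- \<phi> x) *s p" for x
  have \<pi>_poly: "polynomial_fun (\<lambda>x. \<pi> x $ i)" for i
    using polynomial_fun.add[OF polynomial_fun.coord[of i]
        polynomial_fun.mult[OF polynomial_fun_uminus[OF \<phi>(1)] polynomial_fun.const[of "p $ i"]]]
    by (simp add: \<pi>_def)
  have \<pi>_inv: "\<pi> (x + t *s p) = \<pi> x" for x t
    unfolding \<pi>_def \<phi>(2) by (vector algebra_simps)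
  have \<pi>_line: "\<pi> x + t *s p = x + (t - \<phi> x) *s p" for x t
    unfolding \<pi>_def by (vector algebra_simps)
  \<comment> \<open>the product of \<open>t ^ a\<close> and \<open>g\<close>, reduced modulo \<open>Q\<close>; its coefficients are row \<open>a\<close> of the matrix\<close>
  define R where "R x = (\<lambda>a. (monom 1 a * G x) mod Q x)" for x
  define A where "A x = Matrix.mat D D (\<lambda>(a, b). coeff (R x a) b)" for x
  have A: "A x \<in> carrier_mat D D" for x by (simp add: A_def)
  have R_poly: "polynomial_coeffs (\<lambda>x. R x a)" for a
    unfolding R_def
  proof (rule polynomial_coeffs_mod[OF _ _ Q])
    show "degree (monom 1 a * G x) \<le> a + m" for x
      by (rule order_trans[OF degree_mult_le]) (intro add_mono degree_monom_le G)
  qed (intro polynomial_coeffs_mult polynomial_coeffs_const G)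
  have charpoly: "polynomial_coeffs (\<lambda>x. char_poly (A x))"
  proof (rule polynomial_coeffs_char_poly[OF A])
    show "polynomial_fun (\<lambda>x. A x $$ (a, b))" if "a < D" "b < D" for a b
      using that R_poly by (auto simp: A_def polynomial_coeffs_def)
  qed
  define K where "K x = char_poly (A (\<pi> x))" for x
  have root: "poly (char_poly (A x)) (poly (G x) t) = 0" if t: "poly (Q x) t = 0" for x t
  proof -
    have "D \<noteq> 0"
    proof
      assume "D = 0"
      then have "Q x = [:1:]" using Q(2,3)[of x] by (metis degree_eq_zeroE lead_coeff_pCons(2) pCons_0_0 coeff_pCons_0)
      with t show False by simp
    qed
    then have Q0: "Q x \<noteq> 0" using Q(2)[of x] by auto
    have deg: "degree (R x a) < D" for a
      using degree_mod_less'[of "Q x"] Q(2)[of x] Q0 \<open>D \<noteq> 0\<close> unfolding R_def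
      by (metis bot_nat_0.not_eq_extremum degree_0)
    define v where "v = Matrix.vec D (\<lambda>b. t ^ b)"
    have eig: "A x *\<^sub>v v = poly (G x) t \<cdot>\<^sub>v v"
    proof (rule eq_vecI)
      fix a assume "a < dim_vec (poly (G x) t \<cdot>\<^sub>v v)"
      then have a: "a < D" by (simp add: v_def)
      have "vec_index (A x *\<^sub>v v) a = (\<Sum>b<D. coeff (R x a) b * t ^ b)"
        using a by (simp add: A_def v_def scalar_prod_def atLeast0LessThan)
      also have "\<dots> = poly (R x a) t"
        unfolding Polynomial.poly_altdef using deg[of a]
        by (intro sum.mono_neutral_right) (auto simp: coeff_eq_0)
      also have "\<dots> = t ^ a * poly (G x) t"
        using t poly_mod[of "Q x" t "monom 1 a * G x"] by (simp add: R_def poly_monom)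
      finally show "vec_index (A x *\<^sub>v v) a = vec_index (poly (G x) t \<cdot>\<^sub>v v) a"
        using a by (simp add: v_def)
    qed (simp add: A_def v_def)
    moreover have "v \<noteq> 0\<^sub>v D"
    proof
      assume "v = 0\<^sub>v D"
      then have "vec_index v 0 = vec_index (0\<^sub>v D) 0" by simp
      with \<open>D \<noteq> 0\<close> show False by (simp add: v_def)
    qed
    ultimately have "eigenvalue (A x) (poly (G x) t)"
      unfolding eigenvalue_def eigenvector_def using A[of x] by (intro exI[of _ v]) (auto simp: v_def)
    then show ?thesis using eigenvalue_root_char_poly[OF A] by blast
  qed
  show ?thesis
  proof (intro exI[of _ K] exI[of _ D] conjI allI ballI impI)
    show "polynomial_coeffs K"
      unfolding K_def by (rule polynomial_coeffs_compose[OF charpoly \<pi>_poly])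
    show "K (x + t *s p) = K x" for x t by (simp add: K_def \<pi>_inv)
    show "degree (K x) = D" "lead_coeff (K x) = 1" for x
      using degree_monic_char_poly[OF A[of "\<pi> x"]] by (auto simp: K_def)
    show "poly (K x) (g x) = 0" if "x \<in> X" for x
    proof -
      have "\<pi> x + \<phi> x *s p = x" using \<pi>_line[of x "\<phi> x"] by simp
      with that root[OF QX, of "\<pi> x" "\<phi> x"] G(3)[of "\<pi> x" "\<phi> x"] show ?thesis
        by (simp add: K_def)
    qed
    show "poly (K x) 0 \<noteq> 0" if "\<forall>t. g (x + t *s p) = 1" for x
    proof
      assume "poly (K x) 0 = 0"
      then have "eigenvalue (A (\<pi> x)) 0" using eigenvalue_root_char_poly[OF A] by (simp add: K_def)
      moreover have "poly (G (\<pi> x)) t = poly 1 t" for t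
        using G(3)[of "\<pi> x" t] that unfolding \<pi>_line by (metis poly_1)
      then have "G (\<pi> x) = 1" using poly_eq_poly_eq_iff[of "G (\<pi> x)" 1] by (simp add: fun_eq_iff)
      then have "A (\<pi> x) = 1\<^sub>m D"
        using Q(2)[of "\<pi> x"] by (intro eq_matI) (auto simp: A_def R_def mod_poly_less degree_monom_eq)
      ultimately obtain v :: "complex Matrix.vec" where
        v: "v \<in> carrier_vec D" "v \<noteq> 0\<^sub>v D" "1\<^sub>m D *\<^sub>v v = 0 \<cdot>\<^sub>v v"
        by (auto simp: eigenvalue_def eigenvector_def)
      have "0 \<cdot>\<^sub>v v = 0\<^sub>v D" using v(1) by (intro eq_vecI) auto
      with v show False by simp
    qed
  qed
qed

text \<open>
  The restrictions to the line of the polynomials vanishing on \<open>Z\<close> form an ideal of \<open>C[t]\<close>. It is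
  principal, and a root of its generator would be a point of \<open>Z\<close> on the line; so, \<open>C\<close> being
  algebraically closed, the generator is a unit.
\<close>

lemma line_avoiding_unit:
  fixes p :: "complex ^ 'n::finite"
  assumes "p \<noteq> 0" "zariski_closed Z" and avoid: "\<And>t. x + t *s p \<notin> Z"
  obtains g where "polynomial_fun g" "\<And>z. z \<in> Z \<Longrightarrow> g z = 0" "\<And>t. g (x + t *s p) = 1"
proof -
  obtain \<phi> where \<phi>: "\<And>x t. \<phi> (x + t *s p) = \<phi> x + t" "\<And>x. polynomial_fun (\<lambda>y. \<phi> (y - x))"
    using obtain_coordinate_along[OF assms(1)] by metis
  define J where "J = {q. \<exists>g. polynomial_fun g \<and> (\<forall>z\<in>Z. g z = 0) \<and> (\<forall>t. g (x + t *s p) = poly q t)}"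
  have restrict: "\<exists>q\<in>J. \<forall>t. g (x + t *s p) = poly q t" if "polynomial_fun g" "\<forall>z\<in>Z. g z = 0" for g
    using polynomial_fun_expand_along[OF that(1), of p] that unfolding J_def by blast
  have ideal: "q1 + r * q2 \<in> J" if J: "q1 \<in> J" "q2 \<in> J" for q1 q2 r
  proof -
    obtain g1 g2 where g: "polynomial_fun g1" "\<forall>z\<in>Z. g1 z = 0" "\<forall>t. g1 (x + t *s p) = poly q1 t"
      "polynomial_fun g2" "\<forall>z\<in>Z. g2 z = 0" "\<forall>t. g2 (x + t *s p) = poly q2 t"
      using J unfolding J_def by blast
    \<comment> \<open>a polynomial function restricting to \<open>r\<close> on the line, by the coordinate \<open>t\<close> of the line\<close>
    have r: "polynomial_fun (\<lambda>y. poly r (\<phi> (y - x) - \<phi> 0))"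
      using polynomial_fun.add[OF \<phi>(2)[of x] polynomial_fun.const[of "- \<phi> 0"]]
      by (intro polynomial_fun_poly[OF polynomial_coeffs_const _ order_refl]) simp
    have "\<phi> (t *s p) - \<phi> 0 = t" for t using \<phi>(1)[of 0 t] by simp
    then show ?thesis unfolding J_def using g r
      by (intro CollectI exI[of _ "\<lambda>y. g1 y + poly r (\<phi> (y - x) - \<phi> 0) * g2 y"])
        (auto intro!: polynomial_fun.intros)
  qed
  obtain f where f: "polynomial_fun f" "\<And>z. z \<in> Z \<Longrightarrow> f z = 0" "f x \<noteq> 0"
    using zariski_closed_separate[OF assms(2), of x] avoid[of 0] by auto
  obtain q where "q \<in> J" "\<forall>t. f (x + t *s p) = poly q t" using restrict f by blast
  then have "q \<in> J \<and> q \<noteq> 0" using f(3) by (metis poly_0 vec.scale_zero_left add_0_right)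
  then obtain m where m: "m \<in> J" "m \<noteq> 0" and min: "\<And>q. q \<in> J \<Longrightarrow> q \<noteq> 0 \<Longrightarrow> degree m \<le> degree q"
    using ex_has_least_nat[of "\<lambda>q. q \<in> J \<and> q \<noteq> 0" q degree] by blast
  have dvd: "m dvd q" if "q \<in> J" for q
  proof -
    have "q mod m \<in> J"
      using ideal[OF that m(1), of "- (q div m)"] by (simp add: minus_div_mult_eq_mod)
    then have "q mod m = 0" using min degree_mod_less[OF m(2), of q] by fastforce
    then show ?thesis by auto
  qed
  have "degree m = 0"
  proof (rule ccontr)
    assume "degree m \<noteq> 0"
    then obtain t where t: "poly m t = 0"
      using fundamental_theorem_of_algebra[of m] by (auto simp: constant_degree)
    obtain f where "polynomial_fun f" "\<And>z. z \<in> Z \<Longrightarrow> f z = 0" "f (x + t *s p) \<noteq> 0"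
      using zariski_closed_separate[OF assms(2) avoid[of t]] by metis
    moreover then obtain q where "q \<in> J" "\<forall>t. f (x + t *s p) = poly q t" using restrict by blast
    ultimately show False using t dvd[of q] by (metis dvd_def mult_eq_0_iff poly_mult)
  qed
  then obtain c where c: "m = [:c:]" "c \<noteq> 0" using m(2) by (metis degree_eq_zeroE pCons_0_0)
  then have "1 \<in> J"
    using ideal[of m m "[:inverse c - inverse c * c:]"] ideal[OF m(1) m(1), of "[:inverse c - 1:]"] m(1)
    by (simp add: one_pCons algebra_simps)
  then show thesis using that unfolding J_def by (simp, metis)
qed

lemma set_plus_span_singleton: "Z + vec.span {p} = {z + t *s p | z t. z \<in> Z}"
  unfolding set_plus_def vec.span_singleton by blast

text \<open>
  Finite projections are closed. A line that misses \<open>Z\<close> carries the value \<open>1\<close> of some \<open>g\<close> that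
  vanishes on \<open>Z\<close>; the norm of \<open>g\<close> is constant along \<open>p\<close>, vanishes on \<open>Z\<close>, hence on the cylinder over
  \<open>Z\<close>, and separates the given line from it.
\<close>

lemma zariski_closed_plus_line:
  assumes "integral_along p X" "zariski_closed Z" "Z \<subseteq> X"
  shows "zariski_closed (Z + vec.span {p})"
proof (cases "p = 0")
  case True
  then have "Z + vec.span {p} = Z" by (auto simp: set_plus_def)
  with assms show ?thesis by simp
next
  case False
  show ?thesis
  proof (rule zariski_closedI)
    fix x assume "x \<notin> Z + vec.span {p}"
    moreover have "x = (x + t *s p) + (- t) *s p" for t by (vector algebra_simps)
    ultimately have "x + t *s p \<notin> Z" for t unfolding set_plus_span_singleton by blast
    then obtain g where g: "polynomial_fun g" "\<And>z. z \<in> Z \<Longrightarrow> g z = 0" "\<And>t. g (x + t *s p) = 1"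
      using line_avoiding_unit[OF False assms(2)] by metis
    \<comment> \<open>the norm of \<open>g\<close> is, up to sign, the constant term of \<open>K\<close>\<close>
    obtain K D where K: "polynomial_coeffs K" "\<And>x t. K (x + t *s p) = K x"
      "\<And>x. degree (K x) = D" "\<And>x. x \<in> X \<Longrightarrow> poly (K x) (g x) = 0" "poly (K x) 0 \<noteq> 0"
      using integral_equation[OF False assms(1) g(1)] g(3) by blast
    have "polynomial_fun (\<lambda>x. poly (K x) 0)"
      by (rule polynomial_fun_poly[OF K(1), of _ D]) (auto simp: K(3) intro: polynomial_fun.intros)
    moreover have "poly (K z) 0 = 0" if "z \<in> Z + vec.span {p}" for z
      using that assms(3) g(2) K(2,4) unfolding set_plus_span_singleton
      by (smt (verit, best) mem_Collect_eq subsetD)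
    ultimately show "\<exists>f. polynomial_fun f \<and> (\<forall>z\<in>Z + vec.span {p}. f z = 0) \<and> f x \<noteq> 0"
      using K(5) by blast
  qed
qed

text \<open>
  On an irreducible set a factor \<open>g\<close> can be cancelled from the equation of \<open>g\<close> as long as the constant
  term vanishes. The equation being monic, this stops, and the constant term reached is a
  multiple of \<open>g\<close> on \<open>Z\<close>.
\<close>

lemma invariant_constant_term:
  assumes Z: "zariski_irreducible Z" and g: "polynomial_fun g" "z0 \<in> Z" "g z0 \<noteq> 0"
    and "polynomial_coeffs K" "\<And>x t. K (x + t *s p) = K x" "\<And>x. degree (K x) = D" "\<And>x. lead_coeff (K x) = 1"
    and "\<And>z. z \<in> Z \<Longrightarrow> poly (K z) (g z) = 0"
  shows "\<exists>a. polynomial_fun a \<and> (\<forall>x t. a (x + t *s p) = a x) \<and> (\<forall>z\<in>Z. g z = 0 \<longrightarrow> a z = 0) \<and> (\<exists>z\<in>Z. a z \<noteq> 0)"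
  using assms(5-)
proof (induction D arbitrary: K)
  case 0
  then have "K z0 = 1" by (metis degree_eq_zeroE lead_coeff_pCons(2) coeff_pCons_0 one_pCons pCons_0_0)
  with 0(5)[of z0] g(2) show ?case by simp
next
  case (Suc D)
  have val: "poly (K z) s = coeff (K z) 0 + s * poly (poly_shift 1 (K z)) s" for z s
  proof -
    have "K z = pCons (coeff (K z) 0) (poly_shift 1 (K z))"
      by (rule poly_eqI) (simp add: coeff_pCons coeff_poly_shift split: nat.split)
    then have "poly (K z) s = poly (pCons (coeff (K z) 0) (poly_shift 1 (K z))) s" by simp
    then show ?thesis by simp
  qed
  show ?case
  proof (cases "\<exists>z\<in>Z. coeff (K z) 0 \<noteq> 0")
    case True
    have "coeff (K z) 0 = 0" if "z \<in> Z" "g z = 0" for z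
      using val[of z "g z"] Suc.prems(5)[of z] that by simp
    with True Suc.prems(1,2) show ?thesis
      by (intro exI[of _ "\<lambda>z. coeff (K z) 0"]) (auto simp: polynomial_coeffs_def)
  next
    case False
    define K' where "K' x = poly_shift 1 (K x)" for x
    have deg: "degree (K' x) = D \<and> coeff (K' x) D = 1" for x
    proof -
      have "coeff (K' x) D = 1" using Suc.prems(3,4)[of x] by (simp add: K'_def coeff_poly_shift)
      moreover have "degree (K' x) \<le> D"
        using Suc.prems(3)[of x] by (intro degree_le) (auto simp: K'_def coeff_poly_shift intro: coeff_eq_0)
      ultimately show ?thesis by (metis le_antisym le_degree zero_neq_one)
    qed
    have K': "polynomial_coeffs K'"
      using Suc.prems(1) by (simp add: K'_def polynomial_coeffs_def coeff_poly_shift)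
    have "polynomial_fun (\<lambda>z. poly (K' z) (g z))"
      by (rule polynomial_fun_poly[OF K' g(1), of D]) (simp add: deg)
    moreover have "g z * poly (K' z) (g z) = 0" if "z \<in> Z" for z
      using val[of z "g z"] False Suc.prems(5)[OF that] that by (simp add: K'_def)
    ultimately have root: "\<forall>z\<in>Z. poly (K' z) (g z) = 0"
      using zariski_irreducible_mult_eq_0[OF Z g(1), of "\<lambda>z. poly (K' z) (g z)"] g(2,3) by blast
    have inv: "K' (x + t *s p) = K' x" for x t using Suc.prems(2) by (simp add: K'_def)
    show ?thesis by (rule Suc.IH[of K']) (use K' deg root inv in simp_all)
  qed
qed

text \<open>
  Incomparability: a finite projection does not identify an irreducible set with a proper closed
  subset. Choose \<open>g\<close> vanishing on \<open>W\<close> but not on \<open>Z\<close>; the constant term of its equation is constant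
  along \<open>p\<close> and vanishes on \<open>W\<close>, so it vanishes on all of \<open>W + C p\<close>, although not on \<open>Z\<close>.
\<close>

lemma incomparability_along_line:
  assumes "integral_along p X" "zariski_irreducible Z" "Z \<subseteq> X" "zariski_closed W" "W \<subseteq> Z"
    "Z \<subseteq> W + vec.span {p}"
  shows "W = Z"
proof (rule ccontr)
  assume "W \<noteq> Z"
  then obtain z0 where z0: "z0 \<in> Z" "z0 \<notin> W" using assms(5) by blast
  then have "p \<noteq> 0" using assms(6) by (auto simp: set_plus_def)
  obtain g where g: "polynomial_fun g" "\<And>z. z \<in> W \<Longrightarrow> g z = 0" "g z0 \<noteq> 0"
    using zariski_closed_separate[OF assms(4) z0(2)] by metis
  obtain K D where K: "polynomial_coeffs K" "\<And>x t. K (x + t *s p) = K x"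
      "\<And>x. degree (K x) = D" "\<And>x. lead_coeff (K x) = 1" "\<And>x. x \<in> X \<Longrightarrow> poly (K x) (g x) = 0"
    using integral_equation[OF \<open>p \<noteq> 0\<close> assms(1) g(1)] by blast
  have KZ: "poly (K z) (g z) = 0" if "z \<in> Z" for z using K(5) assms(3) that by blast
  obtain a where a_poly: "polynomial_fun a" and a: "\<forall>x t. a (x + t *s p) = a x" "\<forall>z\<in>Z. g z = 0 \<longrightarrow> a z = 0" "\<exists>z\<in>Z. a z \<noteq> 0"
  proof -
    have "\<exists>a. polynomial_fun a \<and> (\<forall>x t. a (x + t *s p) = a x) \<and> (\<forall>z\<in>Z. g z = 0 \<longrightarrow> a z = 0) \<and> (\<exists>z\<in>Z. a z \<noteq> 0)"
      by (rule invariant_constant_term[OF assms(2) g(1) z0(1) g(3) K(1) K(2) K(3) K(4)]) (rule KZ)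
    then show thesis by (elim exE conjE) (rule that; assumption)
  qed
  have "a z = 0" if "z \<in> W + vec.span {p}" for z
    using that a(1,2) g(2) assms(5) unfolding set_plus_span_singleton by auto
  with a(3) assms(6) show False by blast
qed

text \<open>
  If \<open>X \<union> Y\<close> contains a line then \<open>X\<close> or \<open>Y\<close> does. So \<open>Z\<close> is covered by the closed sets \<open>core X\<close> and
  \<open>core Y\<close> of base points whose lines lie in \<open>X\<close> and in \<open>Y\<close>, and one of the two suffices.
\<close>

lemma zariski_irreducible_plus_line:
  assumes Z: "zariski_irreducible Z"
  shows "zariski_irreducible (Z + vec.span {p})"
  unfolding zariski_irreducible_def
proof (intro conjI allI impI)
  show "Z + vec.span {p} \<noteq> {}"
  proof -
    have "Z \<noteq> {}" using Z by (simp add: zariski_irreducible_def)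
    then show ?thesis by (auto simp: set_plus_span_singleton)
  qed
  fix X Y assume X: "zariski_closed X" and Y: "zariski_closed Y" and sub: "Z + vec.span {p} \<subseteq> X \<union> Y"
  define core where "core V = (\<Inter>t. (\<lambda>x. x + t *s p) -` V)" for V
  have closed: "zariski_closed (core V)" if "zariski_closed V" for V
    unfolding core_def
    by (rule zariski_closed_Inter) (use zariski_closed_vimage[OF that polynomial_fun_affine] in blast)
  have "z \<in> core X \<union> core Y" if "z \<in> Z" for z
  proof (rule ccontr)
    assume "z \<notin> core X \<union> core Y"
    then obtain s t where s: "z + s *s p \<notin> X" and t: "z + t *s p \<notin> Y" by (auto simp: core_def)
    obtain f where f: "polynomial_fun f" "\<And>y. y \<in> X \<Longrightarrow> f y = 0" "f (z + s *s p) \<noteq> 0"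
      using zariski_closed_separate[OF X s] by metis
    obtain g where g: "polynomial_fun g" "\<And>y. y \<in> Y \<Longrightarrow> g y = 0" "g (z + t *s p) \<noteq> 0"
      using zariski_closed_separate[OF Y t] by metis
    obtain F G where FG: "\<And>x t. f (x + t *s p) = poly (F x) t" "\<And>x t. g (x + t *s p) = poly (G x) t"
      using polynomial_fun_expand_along[OF f(1)] polynomial_fun_expand_along[OF g(1)] by metis
    have "poly (F z * G z) r = 0" for r
    proof -
      have "z + r *s p \<in> X \<union> Y" using sub that by (auto simp: set_plus_span_singleton)
      then show ?thesis using f(2) g(2) by (auto simp: FG(1)[symmetric] FG(2)[symmetric])
    qed
    then have "F z * G z = 0" using poly_all_0_iff_0 by blast
    then show False using f(3) g(3) by (auto simp: FG)
  qed
  then have "Z \<subseteq> core X \<or> Z \<subseteq> core Y"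
    using Z closed[OF X] closed[OF Y] unfolding zariski_irreducible_def by blast
  then show "Z + vec.span {p} \<subseteq> X \<or> Z + vec.span {p} \<subseteq> Y"
    by (auto simp: set_plus_span_singleton core_def)
qed

section \<open>Finite projections of cones along subspaces\<close>

definition complex_cone :: "(complex ^ 'n::finite) set \<Rightarrow> bool" where
  "complex_cone X \<longleftrightarrow> 0 \<in> X \<and> (\<forall>c. \<forall>x\<in>X. c *s x \<in> X)"

text \<open>
  On a cone the homogeneous parts of a vanishing polynomial vanish as well, and one of these forms is
  nonzero at \<open>p\<close>.
\<close>

lemma integral_along_cone:
  assumes X: "zariski_closed X" "complex_cone X" and p: "p \<notin> X"
  shows "integral_along p X"
proof -
  obtain f where f: "polynomial_fun f" "\<And>x. x \<in> X \<Longrightarrow> f x = 0" "f p \<noteq> 0"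
    using zariski_closed_separate[OF X(1) p] by metis
  obtain H m where H: "\<forall>i. homogeneous_poly i (\<lambda>x. coeff (H x) i)" "\<And>x s. f (s *s x) = poly (H x) s"
    using polynomial_fun_graded[OF f(1)] by blast
  have "H p \<noteq> 0" using H(2)[of 1 p] f(3) by auto
  then obtain d where d: "coeff (H p) d \<noteq> 0" by (meson leading_coeff_0_iff)
  obtain G where G: "polynomial_coeffs G" "\<And>x. degree (G x) \<le> d" "\<And>x. coeff (G x) d = coeff (H p) d"
    "\<And>x t. coeff (H (x + t *s p)) d = poly (G x) t"
    using homogeneous_poly_expand_along[OF H(1)[rule_format, of d], of p] by blast
  have vanish: "coeff (H x) d = 0" if "x \<in> X" for x
  proof -
    have "poly (H x) s = 0" for s
      using H(2)[of s x] f(2)[of "s *s x"] X(2) that by (simp add: complex_cone_def)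
    then have "H x = 0" using poly_all_0_iff_0 by blast
    then show ?thesis by simp
  qed
  have "poly (G x) t = 0" if "x + t *s p \<in> X" for x t
    using vanish[OF that] G(4)[of x t] by simp
  with G(1,2,3) d show ?thesis by (intro integral_alongI[of G d "coeff (H p) d"])
qed

text \<open>
  The first step of Noether normalization: any point where the top form of an equation of \<open>X\<close> is
  nonzero is a good direction.
\<close>

lemma integral_direction_exists:
  fixes X :: "(complex ^ 'n::finite) set"
  assumes X: "zariski_closed X" "X \<noteq> UNIV"
  shows "\<exists>p. integral_along p X"
proof -
  obtain x0 where x0: "x0 \<notin> X" using X(2) by blast
  obtain f where f: "polynomial_fun f" "\<And>x. x \<in> X \<Longrightarrow> f x = 0" "f x0 \<noteq> 0"
    using zariski_closed_separate[OF X(1) x0] by metis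
  obtain H m where H: "\<forall>i. homogeneous_poly i (\<lambda>x. coeff (H x) i)" "\<And>x. degree (H x) \<le> m"
    "\<And>x s. f (s *s x) = poly (H x) s"
    using polynomial_fun_graded[OF f(1)] by blast
  define d where "d = Max (range (\<lambda>x. degree (H x)))"
  have fin: "finite (range (\<lambda>x. degree (H x)))"
    by (rule finite_subset[of _ "{..m}"]) (use H(2) in auto)
  have le: "degree (H x) \<le> d" for x unfolding d_def by (rule Max_ge[OF fin]) simp
  obtain p where p: "degree (H p) = d" using Max_in[OF fin] unfolding d_def by auto
  have nz: "coeff (H p) d \<noteq> 0"
  proof (cases "d = 0")
    case True
    have "H x0 \<noteq> 0" using H(3)[of 1 x0] f(3) by auto
    then have "coeff (H x0) 0 \<noteq> 0" using le[of x0] True by (metis le_zero_eq leading_coeff_0_iff)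
    moreover have "coeff (H x) 0 = f 0" for x using H(3)[of 0 x] by (simp add: poly_0_coeff_0)
    ultimately show ?thesis using True by simp
  next
    case False
    then show ?thesis using p by (metis degree_0 leading_coeff_0_iff)
  qed
  obtain G where G: "polynomial_coeffs G" "\<And>x. degree (G x) \<le> d" "\<And>x. coeff (G x) d = coeff (H p) d"
    "\<And>x t. (\<Sum>i\<le>d. coeff (H (x + t *s p)) i) = poly (G x) t"
    using homogeneous_sum_expand_along[of d "\<lambda>i x. coeff (H x) i" p] H(1) by blast
  \<comment> \<open>no part of degree above \<open>d\<close> occurs, so the part of degree \<open>d\<close> is the top form\<close>
  have "f x = (\<Sum>i\<le>d. coeff (H x) i)" for x
    using H(3)[of 1 x] poly_eq_sum_degree_le[OF le, of x 1] by simp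
  then have fG: "f (x + t *s p) = poly (G x) t" for x t using G(4) by simp
  have "poly (G x) t = 0" if "x + t *s p \<in> X" for x t
    using f(2)[OF that] fG[of x t] by simp
  with G(1,2,3) nz have "integral_along p X" by (intro integral_alongI[of G d "coeff (H p) d"])
  then show ?thesis by blast
qed

lemma integral_along_leaves:
  assumes "integral_along p X"
  shows "\<exists>t. x + t *s p \<notin> X"
proof (rule ccontr)
  assume in_X: "\<not> (\<exists>t. x + t *s p \<notin> X)"
  obtain Q :: "_ \<Rightarrow> complex poly" where "lead_coeff (Q x) = 1" "\<And>t. x + t *s p \<in> X \<Longrightarrow> poly (Q x) t = 0"
    using assms unfolding integral_along_def by blast
  then have "Q x \<noteq> 0" "\<And>t. poly (Q x) t = 0" using in_X by auto
  then show False using poly_all_0_iff_0 by blast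
qed

text \<open>
  The cylinder over a set is built up one direction at a time; all statements about projections along
  subspaces are reduced to lines in this way.
\<close>

lemma set_plus_span_insert: "Z + vec.span (insert p B) = Z + vec.span B + vec.span {p}"
proof -
  have "vec.span (insert p B) = vec.span B + vec.span {p}"
    using vec.span_Un[of B "{p}"] by (auto simp: set_plus_def)
  then show ?thesis by (simp add: add.assoc)
qed

lemma subspace_plus_self:
  assumes "vec.subspace L" shows "L + L = L"
proof
  show "L + L \<subseteq> L" using vec.subspace_add[OF assms] by (auto simp: set_plus_def)
  show "L \<subseteq> L + L" using set_plus_intro[OF _ vec.subspace_0[OF assms], of _ L] by auto
qed

lemma subset_plus_subspace:
  assumes "vec.subspace L" shows "Z \<subseteq> Z + L"
  using set_plus_intro[OF _ vec.subspace_0[OF assms], of _ Z] by auto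

lemma complex_cone_plus_subspace:
  assumes "complex_cone X" "vec.subspace L"
  shows "complex_cone (X + L)"
  unfolding complex_cone_def
proof (intro conjI allI ballI)
  show "0 \<in> X + L" using assms subset_plus_subspace unfolding complex_cone_def by blast
  fix c x assume "x \<in> X + L"
  then obtain y l where "y \<in> X" "l \<in> L" "x = y + l" by (auto simp: set_plus_def)
  with assms show "c *s x \<in> X + L"
    by (auto simp: complex_cone_def vec.scale_right_distrib vec.subspace_scale)
qed

lemma set_plus_span_empty: "Z + vec.span {} = (Z :: (complex ^ 'n::finite) set)"
  by (auto simp: set_plus_def)

lemma zariski_irreducible_plus_span:
  assumes "zariski_irreducible Z" "finite B"
  shows "zariski_irreducible (Z + vec.span B)"
  using assms(2)
proof induction
  case empty
  then show ?case using assms(1) by (simp only: set_plus_span_empty)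
next
  case (insert p B)
  then show ?case by (subst set_plus_span_insert) (rule zariski_irreducible_plus_line)
qed

text \<open>
  At each step the next direction \<open>p\<close> lies outside the cone \<open>X + span B\<close>, since \<open>p = x + b\<close> would put \<open>x\<close>
  into \<open>X \<inter> span (insert p B)\<close>; thus the projection along \<open>p\<close> is finite on that cone.
\<close>

lemma projection_along_span:
  assumes "finite B" "vec.independent B" "zariski_closed X" "complex_cone X" "X \<inter> vec.span B \<subseteq> {0}"
  shows "(\<forall>Z. zariski_closed Z \<longrightarrow> Z \<subseteq> X \<longrightarrow> zariski_closed (Z + vec.span B)) \<and>
    (\<forall>W Z. zariski_closed W \<longrightarrow> zariski_closed Z \<longrightarrow> zariski_irreducible Z \<longrightarrow> W \<subseteq> Z \<longrightarrow> Z \<subseteq> X \<longrightarrow>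
      Z \<subseteq> W + vec.span B \<longrightarrow> W = Z)"
  using assms(1,2,5)
proof (induction B)
  case empty
  then show ?case unfolding set_plus_span_empty by blast
next
  case (insert p B)
  let ?L = "vec.span B"
  have "?L \<subseteq> vec.span (insert p B)" by (rule vec.span_mono) auto
  then have L: "X \<inter> ?L \<subseteq> {0}" using insert.prems(2) by blast
  have indep: "vec.independent B" "p \<notin> ?L"
    using insert.prems(1) insert.hyps(2) by (simp_all add: vec.independent_insert)
  have closed: "zariski_closed (Z + ?L)" if "zariski_closed Z" "Z \<subseteq> X" for Z
    using insert.IH[OF indep(1) L] that by blast
  have strict: "W = Z" if "zariski_closed W" "zariski_closed Z" "zariski_irreducible Z" "W \<subseteq> Z" "Z \<subseteq> X"
    "Z \<subseteq> W + ?L" for W Z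
    using insert.IH[OF indep(1) L] that by blast
  have "p \<notin> X + ?L"
  proof
    assume "p \<in> X + ?L"
    then obtain x l where xl: "x \<in> X" "l \<in> ?L" "p = x + l" by (auto simp: set_plus_def)
    then have "x = p - l" by simp
    moreover have "p - l \<in> vec.span (insert p B)"
      using xl(2) by (meson \<open>?L \<subseteq> vec.span (insert p B)\<close> insertI1 subsetD vec.span_base vec.span_diff)
    ultimately have "x = 0" using insert.prems(2) xl(1) by blast
    with xl indep(2) show False by simp
  qed
  then have int: "integral_along p (X + ?L)"
    using assms(3,4) closed[OF assms(3) order_refl] complex_cone_plus_subspace[OF assms(4) vec.subspace_span]
    by (intro integral_along_cone) auto
  show ?case
  proof (intro conjI allI impI)
    fix Z assume "zariski_closed Z" "Z \<subseteq> X"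
    then show "zariski_closed (Z + vec.span (insert p B))"
      unfolding set_plus_span_insert[of _ p B]
      by (intro zariski_closed_plus_line[OF int] closed set_plus_mono2) auto
  next
    fix W Z assume W: "zariski_closed W" and Z: "zariski_closed Z" "zariski_irreducible Z"
      and sub: "W \<subseteq> Z" "Z \<subseteq> X" and cover: "Z \<subseteq> W + vec.span (insert p B)"
    have "W + ?L + vec.span {p} + ?L = W + (?L + ?L) + vec.span {p}" by (simp only: ac_simps)
    then have "Z + ?L \<subseteq> W + ?L + vec.span {p}"
      using set_plus_mono2[OF cover order_refl, of ?L]
      by (simp add: set_plus_span_insert[of _ p B] subspace_plus_self vec.subspace_span)
    moreover have "zariski_irreducible (Z + ?L)"
      by (rule zariski_irreducible_plus_span[OF Z(2) insert.hyps(1)])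
    moreover have "zariski_closed (W + ?L)" using closed W sub by blast
    ultimately have "W + ?L = Z + ?L"
      by (intro incomparability_along_line[OF int] set_plus_mono2[OF sub(1)] set_plus_mono2[OF sub(2)]) auto
    then have "Z \<subseteq> W + ?L" using subset_plus_subspace[OF vec.subspace_span] by blast
    then show "W = Z" using strict W Z sub by blast
  qed
qed

lemma subspace_basis:
  assumes "vec.subspace L"
  obtains B where "finite B" "vec.independent B" "vec.span B = L"
  by (metis assms vec.basis_exists vec.finiteI_independent vec.span_subspace)

lemma zariski_irreducible_plus_subspace:
  assumes "zariski_irreducible Z" "vec.subspace L"
  shows "zariski_irreducible (Z + L)"
  using subspace_basis[OF assms(2)] zariski_irreducible_plus_span[OF assms(1)] by metis

lemma zariski_closed_plus_subspace:
  assumes "vec.subspace L" "zariski_closed X" "complex_cone X" "X \<inter> L \<subseteq> {0}" "zariski_closed Z" "Z \<subseteq> X"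
  shows "zariski_closed (Z + L)"
proof -
  obtain B where "finite B" "vec.independent B" "vec.span B = L" using subspace_basis[OF assms(1)] .
  with projection_along_span[of B X] assms show ?thesis by blast
qed

lemma incomparability_along_subspace:
  assumes "vec.subspace L" "zariski_closed X" "complex_cone X" "X \<inter> L \<subseteq> {0}"
    "zariski_closed W" "zariski_closed Z" "zariski_irreducible Z" "W \<subseteq> Z" "Z \<subseteq> X" "Z \<subseteq> W + L"
  shows "W = Z"
proof -
  obtain B where "finite B" "vec.independent B" "vec.span B = L" using subspace_basis[OF assms(1)] .
  with projection_along_span[of B X] assms show ?thesis by blast
qed

lemma zariski_irreducible_singleton: "zariski_irreducible {x}"
  unfolding zariski_irreducible_def by auto

lemma zariski_closed_0: "zariski_closed {0 :: complex ^ 'n::finite}"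
proof -
  have "{0} = (\<Inter>i. {x :: complex ^ 'n. x $ i = 0})" by (auto simp: Finite_Cartesian_Product.vec_eq_iff)
  moreover have "zariski_closed (\<Inter>i. {x :: complex ^ 'n. x $ i = 0})"
    by (rule zariski_closed_Inter) (auto intro: zariski_closed_zeros polynomial_fun.intros)
  ultimately show ?thesis by simp
qed

text \<open>
  A subspace is the cylinder over the origin.
\<close>

lemma subspace_zariski:
  assumes "vec.subspace L" shows "zariski_closed L" "zariski_irreducible L"
proof -
  have L: "{0} + L = L" by (auto simp: set_plus_def)
  show "zariski_closed L"
    using zariski_closed_plus_subspace[OF assms zariski_closed_0 _ _ zariski_closed_0 order_refl]
    by (simp add: L complex_cone_def)
  show "zariski_irreducible L"
    using zariski_irreducible_plus_subspace[OF zariski_irreducible_singleton assms, of 0] by (simp add: L)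
qed

section \<open>Chains in a cone are short\<close>

definition irreducible_chain :: "nat \<Rightarrow> (nat \<Rightarrow> (complex ^ 'n::finite) set) \<Rightarrow> bool" where
  "irreducible_chain k Z \<longleftrightarrow> (\<forall>i\<le>k. zariski_closed (Z i) \<and> zariski_irreducible (Z i)) \<and>
    (\<forall>i<k. Z i \<subset> Z (Suc i))"

lemma irreducible_chain_mono:
  assumes "irreducible_chain k Z" "i \<le> j" "j \<le> k"
  shows "Z i \<subseteq> Z j"
  using assms(2,3)
proof (induction j rule: dec_induct)
  case (step j)
  then show ?case using assms(1) unfolding irreducible_chain_def by (meson Suc_le_lessD less_imp_le order_trans psubsetE)
qed simp

text \<open>
  The induction projects along one more direction for each member of the chain. All members but the
  last lie in a proper closed set, which is finite along some \<open>p\<close>; such a \<open>p\<close> lies outside \<open>L\<close>, as the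
  set is \<open>L\<close>-invariant. The cylinders over these members form a strict chain, by
  incomparability, that is invariant under the larger subspace spanned by \<open>L\<close> and \<open>p\<close>.
\<close>

lemma invariant_chain_length:
  fixes Z :: "nat \<Rightarrow> (complex ^ 'n::finite) set"
  assumes "irreducible_chain k Z" "vec.subspace L" "\<And>i. i \<le> k \<Longrightarrow> Z i + L = Z i"
  shows "k + vec.dim L \<le> CARD('n)"
  using assms
proof (induction k arbitrary: Z L)
  case 0
  show ?case using vec.dim_subset_UNIV[of L] by (simp add: vec.dimension_def card_cart_basis)
next
  case (Suc k)
  have Zk: "zariski_closed (Z k)" "Z k \<noteq> UNIV" "Z k \<noteq> {}"
    using Suc.prems(1) by (auto simp: irreducible_chain_def zariski_irreducible_def)
  then obtain p where p: "integral_along p (Z k)" using integral_direction_exists by blast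
  have "p \<notin> L"
  proof
    assume "p \<in> L"
    obtain x where "x \<in> Z k" using Zk(3) by blast
    then have "x + t *s p \<in> Z k + L" for t
      using \<open>p \<in> L\<close> Suc.prems(2) by (intro set_plus_intro vec.subspace_scale)
    then show False using integral_along_leaves[OF p, of x] Suc.prems(3)[of k] by auto
  qed
  define Z' where "Z' i = Z i + vec.span {p}" for i
  have below: "Z i \<subseteq> Z k" if "i \<le> k" for i using irreducible_chain_mono[OF Suc.prems(1) that] by simp
  have "irreducible_chain k Z'"
    unfolding irreducible_chain_def
  proof (intro conjI allI impI)
    fix i assume i: "i \<le> k"
    then have Zi: "zariski_closed (Z i)" "zariski_irreducible (Z i)"
      using Suc.prems(1) by (auto simp: irreducible_chain_def)
    show "zariski_closed (Z' i)"
      unfolding Z'_def by (rule zariski_closed_plus_line[OF p Zi(1) below[OF i]])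
    show "zariski_irreducible (Z' i)"
      unfolding Z'_def by (rule zariski_irreducible_plus_line[OF Zi(2)])
  next
    fix i assume i: "i < k"
    then have Zi: "zariski_closed (Z i)" "zariski_irreducible (Z (Suc i))" "Z i \<subset> Z (Suc i)"
      using Suc.prems(1) by (auto simp: irreducible_chain_def)
    have "Z' i \<subseteq> Z' (Suc i)" unfolding Z'_def using Zi(3) by (intro set_plus_mono2) auto
    moreover have "Z' i \<noteq> Z' (Suc i)"
    proof
      assume "Z' i = Z' (Suc i)"
      then have "Z (Suc i) \<subseteq> Z i + vec.span {p}"
        unfolding Z'_def using subset_plus_subspace[OF vec.subspace_span] by blast
      then have "Z i = Z (Suc i)"
        using Zi i by (intro incomparability_along_line[OF p _ below]) auto
      with Zi(3) show False by simp
    qed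
    ultimately show "Z' i \<subset> Z' (Suc i)" by blast
  qed
  moreover have "vec.subspace (vec.span (insert p L))" by (rule vec.subspace_span)
  moreover have "Z' i + vec.span (insert p L) = Z' i" if "i \<le> k" for i
  proof -
    have "Z' i + vec.span (insert p L) = Z' i + L + vec.span {p}"
      using set_plus_span_insert[of "Z' i" p L] Suc.prems(2) by (simp add: vec.span_eq_iff[THEN iffD2])
    also have "\<dots> = (Z i + L) + (vec.span {p} + vec.span {p})" by (simp only: Z'_def ac_simps)
    finally show ?thesis
      using Suc.prems(3)[of i] that by (simp add: subspace_plus_self vec.subspace_span Z'_def)
  qed
  ultimately have "k + vec.dim (vec.span (insert p L)) \<le> CARD('n)" by (rule Suc.IH)
  moreover have "vec.dim (vec.span (insert p L)) = vec.dim L + 1"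
    using \<open>p \<notin> L\<close> Suc.prems(2) by (simp add: vec.dim_insert vec.span_eq_iff[THEN iffD2])
  ultimately show ?case by simp
qed

text \<open>
  Passing to the cylinders over \<open>L\<close> keeps the chain strict and makes it \<open>L\<close>-invariant.
\<close>

lemma chain_length_le_codim:
  fixes X :: "(complex ^ 'n::finite) set"
  assumes "zariski_closed X" "complex_cone X" "vec.subspace L" "X \<inter> L \<subseteq> {0}"
    and "irreducible_chain k Z" "\<And>i. i \<le> k \<Longrightarrow> Z i \<subseteq> X"
  shows "k + vec.dim L \<le> CARD('n)"
proof (rule invariant_chain_length[OF _ assms(3)])
  show "irreducible_chain k (\<lambda>i. Z i + L)"
    unfolding irreducible_chain_def
  proof (intro conjI allI impI)
    fix i assume i: "i \<le> k"
    then show "zariski_closed (Z i + L)" "zariski_irreducible (Z i + L)"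
      using assms(5) zariski_closed_plus_subspace[OF assms(3,1,2,4) _ assms(6)[OF i]]
        zariski_irreducible_plus_subspace[OF _ assms(3)]
      by (auto simp: irreducible_chain_def)
  next
    fix i assume i: "i < k"
    then have Zi: "zariski_closed (Z i)" "zariski_closed (Z (Suc i))" "zariski_irreducible (Z (Suc i))"
      "Z i \<subset> Z (Suc i)"
      using assms(5) by (auto simp: irreducible_chain_def)
    have "Z i + L \<subseteq> Z (Suc i) + L" using Zi(4) by (intro set_plus_mono2) auto
    moreover have "Z i + L \<noteq> Z (Suc i) + L"
    proof
      assume "Z i + L = Z (Suc i) + L"
      then have "Z (Suc i) \<subseteq> Z i + L" using subset_plus_subspace[OF assms(3)] by blast
      then have "Z i = Z (Suc i)"
        using Zi i assms(6)[of "Suc i"] by (intro incomparability_along_subspace[OF assms(3,1,2,4)]) auto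
      with Zi(4) show False by simp
    qed
    ultimately show "Z i + L \<subset> Z (Suc i) + L" by blast
  qed
  show "Z i + L + L = Z i + L" for i by (simp add: add.assoc subspace_plus_self assms(3))
qed

section \<open>Lifting chains along a projection\<close>

lemma norm_complex_scale: "norm (c *s x) = cmod c * norm (x :: complex ^ 'n::finite)"
  by (simp add: norm_vec_def L2_set_def norm_mult power_mult_distrib sum_distrib_left[symmetric] real_sqrt_mult)

text \<open>
  On the compact unit sphere of \<open>X\<close> the distance to \<open>L\<close> has a positive lower bound \<open>d\<close>. By homogeneity
  every \<open>x\<close> in \<open>X\<close> has distance at least \<open>d * norm x\<close> from \<open>L\<close>, whereas this distance is at most
  \<open>norm w\<close> on the fibre.
\<close>

lemma compact_cone_fibre:
  fixes X :: "(complex ^ 'n::finite) set"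
  assumes X: "closed X" "complex_cone X" and L: "vec.subspace L" "closed L" and "X \<inter> L \<subseteq> {0}"
  shows "compact (X \<inter> {x. w - x \<in> L})"
proof -
  have "closed ((\<lambda>x. w - x) -` L)" by (intro closed_vimage L(2) continuous_intros)
  then have "closed (X \<inter> {x. w - x \<in> L})" using X(1) by (auto simp: vimage_def)
  moreover have "bounded (X \<inter> {x. w - x \<in> L})"
  proof -
    have "X \<inter> sphere 0 1 \<inter> L = {}" using assms(5) by force
    then obtain d where d: "d > 0" "\<And>x y. x \<in> X \<inter> sphere 0 1 \<Longrightarrow> y \<in> L \<Longrightarrow> d \<le> dist x y"
      using separate_compact_closed[of "X \<inter> sphere 0 1" L] L(2) X(1) by (metis closed_Int_compact compact_sphere)
    have "norm x \<le> norm w / d" if x: "x \<in> X" "w - x \<in> L" for x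
    proof (cases "x = 0")
      case False
      define c where "c = complex_of_real (inverse (norm x))"
      have c: "cmod c = inverse (norm x)" unfolding c_def by (simp add: norm_inverse)
      have "c *s x \<in> X \<inter> sphere 0 1"
        using X(2) x(1) False by (simp add: complex_cone_def norm_complex_scale c)
      moreover have "- (c *s (w - x)) \<in> L" by (intro vec.subspace_neg vec.subspace_scale L(1) x(2))
      ultimately have "d \<le> dist (c *s x) (- (c *s (w - x)))" by (rule d(2))
      also have "c *s x + c *s (w - x) = c *s w" by (simp add: vec.scale_right_diff_distrib)
      then have "dist (c *s x) (- (c *s (w - x))) = norm w / norm x"
        by (simp add: dist_norm norm_complex_scale c divide_inverse)
      finally show ?thesis using d(1) False by (simp add: field_simps)
    qed (use d(1) in simp)
    then show ?thesis unfolding bounded_iff by (intro exI[of _ "norm w / d"]) auto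
  qed
  ultimately show ?thesis using compact_eq_bounded_closed by blast
qed

text \<open>
  A minimal closed subset \<open>M\<close> of \<open>Z \<inter> W\<close> whose cylinder still covers \<open>W\<close> is irreducible: if \<open>M\<close> is the
  union of two closed parts, the closed cylinders over them cover \<open>W\<close>, so one of them does, and by
  minimality the part is \<open>M\<close>. Zorn's lemma provides \<open>M\<close>, since the intersection of a descending
  family still covers \<open>W\<close>: the fibres are compact, so a descending family of nonempty fibres has
  a common point.
\<close>

lemma lift_irreducible:
  fixes X :: "(complex ^ 'n::finite) set"
  assumes X: "zariski_closed X" "complex_cone X" and L: "vec.subspace L" "X \<inter> L \<subseteq> {0}"
    and Z: "zariski_closed Z" "Z \<subseteq> X" and W: "zariski_closed W" "zariski_irreducible W" "W + L = W" "W \<subseteq> Z + L"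
  shows "\<exists>Z'. zariski_closed Z' \<and> zariski_irreducible Z' \<and> Z' \<subseteq> Z \<and> Z' + L = W"
proof -
  define \<A> where "\<A> = {V. zariski_closed V \<and> V \<subseteq> Z \<inter> W \<and> W \<subseteq> V + L}"
  have top: "Z \<inter> W \<in> \<A>"
  proof -
    have "w \<in> Z \<inter> W + L" if w: "w \<in> W" for w
    proof -
      obtain z l where zl: "z \<in> Z" "l \<in> L" "w = z + l" using W(4) w by (auto simp: set_plus_def)
      then have "z = w + (- l)" by simp
      then have "z \<in> W + L" using w zl(2) vec.subspace_neg[OF L(1)] by blast
      with zl W(3) show ?thesis by blast
    qed
    then show ?thesis using zariski_closed_Int[OF Z(1) W(1)] by (auto simp: \<A>_def)
  qed
  have Inter: "\<Inter>C \<in> \<A>" if C: "C \<noteq> {}" "C \<subseteq> \<A>" "\<And>U V. U \<in> C \<Longrightarrow> V \<in> C \<Longrightarrow> U \<subseteq> V \<or> V \<subseteq> U" for C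
  proof -
    have "w \<in> \<Inter>C + L" if w: "w \<in> W" for w
    proof -
      let ?S = "X \<inter> {x. w - x \<in> L}"
      have meets: "?S \<inter> V \<noteq> {}" if V: "V \<in> C" for V
      proof -
        obtain x l where "x \<in> V" "l \<in> L" "w = x + l" using C(2) V w unfolding \<A>_def set_plus_def by blast
        moreover have "V \<subseteq> X" using C(2) V Z(2) unfolding \<A>_def by blast
        ultimately show ?thesis by auto
      qed
      have "?S \<inter> \<Inter>C \<noteq> {}"
      proof (rule compact_imp_fip)
        show "compact ?S"
          using X L subspace_zariski[OF L(1)] by (intro compact_cone_fibre zariski_closed_imp_closed)
        show "closed V" if "V \<in> C" for V
          using C(2) that unfolding \<A>_def by (blast intro: zariski_closed_imp_closed)
        fix F assume F: "finite F" "F \<subseteq> C"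
        show "?S \<inter> \<Inter>F \<noteq> {}"
        proof (cases "F = {}")
          case True
          obtain V where "V \<in> C" using C(1) by blast
          then show ?thesis using meets[of V] True by auto
        next
          case False
          obtain V where V: "V \<in> F" "\<And>U. U \<in> F \<Longrightarrow> U \<subseteq> V \<Longrightarrow> V = U"
            using finite_has_minimal[OF F(1) False] by blast
          then have "V \<subseteq> U" if "U \<in> F" for U using C(3)[of U V] F(2) that by blast
          then have "V \<subseteq> \<Inter>F" by blast
          then show ?thesis using meets[of V] V(1) F(2) by blast
        qed
      qed
      then obtain x where "x \<in> \<Inter>C" "w - x \<in> L" by blast
      then show ?thesis using set_plus_intro[of x "\<Inter>C" "w - x" L] by simp
    qed
    moreover have "zariski_closed (\<Inter>C)" by (rule zariski_closed_Inter) (use C(2) \<A>_def in auto)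
    moreover have "\<Inter>C \<subseteq> Z \<inter> W" using C(1,2) unfolding \<A>_def by blast
    ultimately show ?thesis unfolding \<A>_def by blast
  qed
  have "\<exists>M\<in>\<A>. \<forall>V\<in>\<A>. V \<subseteq> M \<longrightarrow> V = M"
  proof (rule predicate_Zorn[where P = "\<lambda>U V. V \<subseteq> U"])
    show "partial_order_on \<A> (relation_of (\<lambda>U V. V \<subseteq> U) \<A>)"
      by (rule partial_order_on_relation_ofI) auto
    fix C assume C: "C \<in> Chains (relation_of (\<lambda>U V. V \<subseteq> U) \<A>)"
    then have sub: "C \<subseteq> \<A>" by (rule Chains_relation_of)
    show "\<exists>U\<in>\<A>. \<forall>V\<in>C. U \<subseteq> V"
    proof (cases "C = {}")
      case False
      have "U \<subseteq> V \<or> V \<subseteq> U" if "U \<in> C" "V \<in> C" for U V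
        using C that unfolding Chains_def relation_of_def by blast
      then show ?thesis using Inter[OF False sub] by blast
    qed (use top in blast)
  qed
  then obtain M where M: "M \<in> \<A>" and min: "\<And>V. V \<in> \<A> \<Longrightarrow> V \<subseteq> M \<Longrightarrow> V = M" by blast
  then have M': "zariski_closed M" "M \<subseteq> Z" "M \<subseteq> W" "W \<subseteq> M + L" by (auto simp: \<A>_def)
  have "zariski_irreducible M"
    unfolding zariski_irreducible_def
  proof (intro conjI allI impI)
    have "W \<noteq> {}" using W(2) by (simp add: zariski_irreducible_def)
    then show "M \<noteq> {}" using M'(4) by (auto simp: set_plus_def)
    fix A B assume A: "zariski_closed A" and B: "zariski_closed B" and AB: "M \<subseteq> A \<union> B"
    have closed: "zariski_closed (M \<inter> A + L)" "zariski_closed (M \<inter> B + L)"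
      using M' Z(2) zariski_closed_Int A B
      by (auto intro!: zariski_closed_plus_subspace[OF L(1) X L(2)])
    have "W \<subseteq> (M \<inter> A + L) \<union> (M \<inter> B + L)"
    proof -
      have "M \<inter> A \<union> M \<inter> B = M" using AB by blast
      then show ?thesis using M'(4) Un_set_plus[of "M \<inter> A" "M \<inter> B" L] by simp
    qed
    then have "W \<subseteq> M \<inter> A + L \<or> W \<subseteq> M \<inter> B + L"
      using W(2) closed unfolding zariski_irreducible_def by blast
    then have "M \<inter> A \<in> \<A> \<or> M \<inter> B \<in> \<A>"
      using zariski_closed_Int[OF M'(1) A] zariski_closed_Int[OF M'(1) B] M'(2,3) unfolding \<A>_def by blast
    then show "M \<subseteq> A \<or> M \<subseteq> B" using min[of "M \<inter> A"] min[of "M \<inter> B"] by blast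
  qed
  moreover have "M + L = W" using M'(3,4) set_plus_mono2[OF M'(3) order_refl, of L] W(3) by blast
  ultimately show ?thesis using M' by blast
qed

text \<open>
  Going down from the top member, each lift being taken inside the previous one.
\<close>

lemma lift_chain:
  fixes X :: "(complex ^ 'n::finite) set"
  assumes X: "zariski_closed X" "complex_cone X" and L: "vec.subspace L" "X \<inter> L \<subseteq> {0}"
    and "irreducible_chain k W" "\<And>i. i \<le> k \<Longrightarrow> W i + L = W i"
    and "zariski_closed V" "V \<subseteq> X" "W k \<subseteq> V + L"
  shows "\<exists>Z. irreducible_chain k Z \<and> (\<forall>i\<le>k. Z i \<subseteq> V \<and> Z i + L = W i)"
  using assms(5-)
proof (induction k arbitrary: V)
  case 0
  then obtain Z0 where "zariski_closed Z0" "zariski_irreducible Z0" "Z0 \<subseteq> V" "Z0 + L = W 0"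
    using lift_irreducible[OF X L, of V "W 0"] by (auto simp: irreducible_chain_def)
  then show ?case by (intro exI[of _ "\<lambda>_. Z0"]) (auto simp: irreducible_chain_def)
next
  case (Suc k)
  obtain Y where Y: "zariski_closed Y" "zariski_irreducible Y" "Y \<subseteq> V" "Y + L = W (Suc k)"
    using lift_irreducible[OF X L, of V "W (Suc k)"] Suc.prems by (auto simp: irreducible_chain_def)
  have strict: "W i \<subset> W (Suc i)" if "i \<le> k" for i
    using Suc.prems(1) that by (simp add: irreducible_chain_def)
  have "irreducible_chain k W" using Suc.prems(1) by (auto simp: irreducible_chain_def)
  then have "\<exists>Z. irreducible_chain k Z \<and> (\<forall>i\<le>k. Z i \<subseteq> Y \<and> Z i + L = W i)"
  proof (rule Suc.IH)
    show "W i + L = W i" if "i \<le> k" for i using Suc.prems(2) that by simp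
    show "Y \<subseteq> X" using Y(3) Suc.prems(4) by blast
    show "W k \<subseteq> Y + L" using strict[of k] Y(4) by auto
  qed (rule Y(1))
  then obtain Z where Z: "irreducible_chain k Z" "\<And>i. i \<le> k \<Longrightarrow> Z i \<subseteq> Y" "\<And>i. i \<le> k \<Longrightarrow> Z i + L = W i"
    by blast
  have "Z k \<subset> Y" using Z(2,3)[of k] Y(4) strict[of k] by auto
  then have "irreducible_chain (Suc k) (Z(Suc k := Y))"
    using Z(1) Y(1,2) by (auto simp: irreducible_chain_def less_Suc_eq le_Suc_eq)
  moreover have "(Z(Suc k := Y)) i \<subseteq> V \<and> (Z(Suc k := Y)) i + L = W i" if "i \<le> Suc k" for i
    using Z(2,3)[of i] Y(3,4) that by (cases "i = Suc k") auto
  ultimately show ?case by blast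
qed

lemma subspace_flag:
  fixes L :: "(complex ^ 'n::finite) set"
  assumes "vec.subspace L" "k + vec.dim L \<le> CARD('n)"
  shows "\<exists>W. (\<forall>i\<le>k. vec.subspace (W i) \<and> L \<subseteq> W i) \<and> (\<forall>i<k. W i \<subset> W (Suc i))"
  using assms
proof (induction k arbitrary: L)
  case 0
  then show ?case by (intro exI[of _ "\<lambda>_. L"]) auto
next
  case (Suc k)
  have "L \<noteq> UNIV"
    using Suc.prems(2) by (auto simp: card_cart_basis)
  then obtain p where p: "p \<notin> L" by blast
  let ?L = "vec.span (insert p L)"
  have "vec.dim ?L = vec.dim L + 1"
    using p Suc.prems(1) by (simp add: vec.dim_insert vec.span_eq_iff[THEN iffD2])
  with Suc.prems(2) obtain W where W: "\<forall>i\<le>k. vec.subspace (W i) \<and> ?L \<subseteq> W i" "\<forall>i<k. W i \<subset> W (Suc i)"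
    using Suc.IH[of ?L] vec.subspace_span by auto
  have "L \<subseteq> ?L" "p \<in> ?L" by (auto intro: vec.span_base)
  then have "L \<subset> W 0" "\<And>i. i \<le> k \<Longrightarrow> L \<subseteq> W i" using W(1) p by blast+
  then show ?case
    using W Suc.prems(1) by (intro exI[of _ "\<lambda>i. case i of 0 \<Rightarrow> L | Suc j \<Rightarrow> W j"]) (auto split: nat.split)
qed

text \<open>
  Half of the description of the dimension of a cone by complementary subspaces.
\<close>

lemma krull_dim_le_codim:
  fixes X :: "(complex ^ 'n::finite) set"
  assumes "zariski_closed X" "complex_cone X" "vec.subspace L" "X \<inter> L \<subseteq> {0}"
  shows "krull_dim X \<le> enat (CARD('n) - vec.dim L)"
  unfolding krull_dim_def
proof (rule Sup_least, clarify)
  fix k and Z :: "nat \<Rightarrow> (complex ^ 'n) set"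
  assume "\<forall>i\<le>k. zariski_closed (Z i) \<and> zariski_irreducible (Z i) \<and> Z i \<subseteq> X" "\<forall>i<k. Z i \<subset> Z (Suc i)"
  then have "k + vec.dim L \<le> CARD('n)"
    by (intro chain_length_le_codim[OF assms, of k Z]) (auto simp: irreducible_chain_def)
  then show "enat k \<le> enat (CARD('n) - vec.dim L)" by simp
qed

text \<open>
  The other half. A subspace \<open>L\<close> of maximal dimension that meets \<open>Y\<close> only in the origin satisfies
  \<open>Y + L = UNIV\<close>, as any further direction could be added to it. A full flag of subspaces above \<open>L\<close>
  then lifts to a chain in \<open>Y\<close>.
\<close>

lemma exists_complement_krull_dim_ge:
  fixes Y :: "(complex ^ 'n::finite) set"
  assumes Y: "zariski_closed Y" "complex_cone Y"
  shows "\<exists>L. vec.subspace L \<and> Y \<inter> L \<subseteq> {0} \<and> enat (CARD('n) - vec.dim L) \<le> krull_dim Y"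
proof -
  let ?P = "\<lambda>L. vec.subspace L \<and> Y \<inter> L \<subseteq> {0}"
  have bound: "vec.dim L \<le> CARD('n)" for L :: "(complex ^ 'n) set"
    using vec.dim_subset_UNIV[of L] by (simp add: vec.dimension_def card_cart_basis)
  have "?P {0}" by (simp add: vec.subspace_single_0)
  then obtain L where L: "?P L" and max: "\<And>L'. ?P L' \<Longrightarrow> vec.dim L' \<le> vec.dim L"
    using ex_has_greatest_nat[of ?P "{0}" vec.dim "CARD('n) + 1"] bound by (metis less_Suc_eq_le Suc_eq_plus1 le_SucI)
  have "Y + L = UNIV"
  proof (rule ccontr)
    assume "Y + L \<noteq> UNIV"
    then obtain p where p: "p \<notin> Y + L" by blast
    have "p \<notin> L" using p set_plus_intro[of 0 Y p L] Y(2) by (auto simp: complex_cone_def)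
    have "Y \<inter> vec.span (insert p L) \<subseteq> {0}"
    proof
      fix y assume y: "y \<in> Y \<inter> vec.span (insert p L)"
      then obtain c where c: "y - c *s p \<in> L"
        using L by (auto simp: vec.span_insert vec.span_eq_iff[THEN iffD2])
      \<comment> \<open>otherwise rescaling would put \<open>p\<close> into \<open>Y + L\<close>\<close>
      have "c = 0"
      proof (rule ccontr)
        assume "c \<noteq> 0"
        have "p = inverse c *s y + (- inverse c) *s (y - c *s p)"
          using \<open>c \<noteq> 0\<close> by (vector field_simps)
        moreover have "inverse c *s y \<in> Y" using Y(2) y by (simp add: complex_cone_def)
        moreover have "(- inverse c) *s (y - c *s p) \<in> L" using L c by (intro vec.subspace_scale) auto
        ultimately have "p \<in> Y + L" by (metis set_plus_intro)
        with p show False by blast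
      qed
      with c y L show "y \<in> {0}" by auto
    qed
    then have "vec.dim (vec.span (insert p L)) \<le> vec.dim L" by (intro max) (simp add: vec.subspace_span)
    then show False using \<open>p \<notin> L\<close> L by (simp add: vec.dim_insert vec.span_eq_iff[THEN iffD2])
  qed
  define k where "k = CARD('n) - vec.dim L"
  obtain W where W: "\<forall>i\<le>k. vec.subspace (W i) \<and> L \<subseteq> W i" "\<forall>i<k. W i \<subset> W (Suc i)"
    using subspace_flag[of L k] L bound[of L] k_def by auto
  have "irreducible_chain k W" using W subspace_zariski unfolding irreducible_chain_def by blast
  moreover have "W i + L = W i" if "i \<le> k" for i
  proof
    have Wi: "vec.subspace (W i)" "L \<subseteq> W i" using W(1) that by auto
    show "W i + L \<subseteq> W i"
      using set_plus_mono2[OF order_refl[of "W i"] Wi(2)] by (simp add: subspace_plus_self[OF Wi(1)])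
    show "W i \<subseteq> W i + L" using L by (intro subset_plus_subspace) auto
  qed
  ultimately obtain Z where Z: "irreducible_chain k Z" "\<forall>i\<le>k. Z i \<subseteq> Y \<and> Z i + L = W i"
    using lift_chain[OF Y, of L k W Y] L Y(1) \<open>Y + L = UNIV\<close> by auto
  then have "enat k \<le> krull_dim Y"
    unfolding krull_dim_def
    by (intro Sup_upper CollectI exI[of _ k] exI[of _ Z] conjI refl) (auto simp: irreducible_chain_def)
  then show ?thesis using L k_def by blast
qed

section \<open>Singular loci\<close>

lemma polynomial_fun_gradient:
  fixes f :: "complex ^ 'n::finite \<Rightarrow> complex"
  assumes "polynomial_fun f"
  shows "\<exists>D. (\<forall>j. polynomial_fun (D j)) \<and>
    (\<forall>x v. ((\<lambda>z. f (x + z *s v)) has_field_derivative (\<Sum>j\<in>UNIV. v $ j * D j x)) (at 0))"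
  using assms
proof induction
  case (const c)
  show ?case by (intro exI[of _ "\<lambda>_ _. 0"]) (auto intro: polynomial_fun.const)
next
  case (coord i)
  have "(\<Sum>j\<in>UNIV. v $ j * (if j = i then 1 else 0)) = v $ i" for v :: "complex ^ 'n"
    by (simp add: if_distrib cong: if_cong)
  then show ?case
    by (intro exI[of _ "\<lambda>j _. if j = i then 1 else 0"])
      (auto intro!: polynomial_fun.const derivative_eq_intros)
next
  case (add f g)
  then obtain F G where
    F: "\<And>j. polynomial_fun (F j)"
      "\<And>x v. ((\<lambda>z. f (x + z *s v)) has_field_derivative (\<Sum>j\<in>UNIV. v $ j * F j x)) (at 0)" and
    G: "\<And>j. polynomial_fun (G j)"
      "\<And>x v. ((\<lambda>z. g (x + z *s v)) has_field_derivative (\<Sum>j\<in>UNIV. v $ j * G j x)) (at 0)"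
    by blast
  have "((\<lambda>z. f (x + z *s v) + g (x + z *s v)) has_field_derivative
      (\<Sum>j\<in>UNIV. v $ j * (F j x + G j x))) (at 0)" for x v
    using DERIV_add[OF F(2) G(2), of x v x v] by (simp add: distrib_left sum.distrib)
  then show ?case using F(1) G(1)
    by (intro exI[of _ "\<lambda>j x. F j x + G j x"]) (auto intro: polynomial_fun.add)
next
  case (mult f g)
  then obtain F G where
    F: "\<And>j. polynomial_fun (F j)"
      "\<And>x v. ((\<lambda>z. f (x + z *s v)) has_field_derivative (\<Sum>j\<in>UNIV. v $ j * F j x)) (at 0)" and
    G: "\<And>j. polynomial_fun (G j)"
      "\<And>x v. ((\<lambda>z. g (x + z *s v)) has_field_derivative (\<Sum>j\<in>UNIV. v $ j * G j x)) (at 0)"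
    by blast
  have "((\<lambda>z. f (x + z *s v) * g (x + z *s v)) has_field_derivative
      (\<Sum>j\<in>UNIV. v $ j * (F j x * g x + f x * G j x))) (at 0)" for x v
    using DERIV_mult[OF F(2) G(2), of x v x v]
    by (simp add: distrib_left sum.distrib sum_distrib_left sum_distrib_right mult_ac)
  then show ?case using F(1) G(1) mult.hyps
    by (intro exI[of _ "\<lambda>j x. F j x * g x + f x * G j x"]) (auto intro!: polynomial_fun.intros(3,4))
qed

lemma axis_eq_scale: "axis j z = z *s (axis j 1 :: complex ^ 'n::finite)"
  by (simp add: axis_def Finite_Cartesian_Product.vec_eq_iff)

lemma partial_deriv_polynomial:
  fixes f :: "complex ^ 'n::finite \<Rightarrow> complex"
  assumes "polynomial_fun f"
  shows "polynomial_fun (partial_deriv j f)"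
    and "((\<lambda>z. f (x + z *s v)) has_field_derivative (\<Sum>j\<in>UNIV. v $ j * partial_deriv j f x)) (at 0)"
proof -
  obtain D where D: "\<And>j. polynomial_fun (D j)"
      "\<And>x v. ((\<lambda>z. f (x + z *s v)) has_field_derivative (\<Sum>j\<in>UNIV. v $ j * D j x)) (at 0)"
    using polynomial_fun_gradient[OF assms] by blast
  have pd: "partial_deriv j f x = D j x" for j x
  proof -
    have "(\<Sum>i\<in>UNIV. axis j 1 $ i * D i x) = D j x"
      by (simp add: axis_def if_distrib if_distribR cong: if_cong)
    then have "((\<lambda>z. f (x + axis j z)) has_field_derivative D j x) (at 0)"
      using D(2)[of x "axis j 1"] by (simp add: axis_eq_scale[symmetric])
    then show ?thesis unfolding partial_deriv_def by (rule DERIV_imp_deriv)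
  qed
  have "partial_deriv j f = D j" by (rule ext) (rule pd)
  then show "polynomial_fun (partial_deriv j f)" using D(1) by simp
  show "((\<lambda>z. f (x + z *s v)) has_field_derivative (\<Sum>j\<in>UNIV. v $ j * partial_deriv j f x)) (at 0)"
    using D(2) by (simp add: pd)
qed

lemma polynomial_fun_assoc_poly: "polynomial_fun (assoc_poly T)"
proof -
  have "assoc_poly T = (\<lambda>x. \<Sum>i\<in>UNIV. T $ i * (\<Prod>k\<in>UNIV. x $ i k))"
    by (rule ext) (rule assoc_poly_def)
  then show ?thesis
    by (auto intro!: polynomial_fun_sum polynomial_fun.mult polynomial_fun_prod polynomial_fun.const polynomial_fun.coord)
qed

lemma assoc_poly_scale:
  fixes T :: "('d::finite, 'n::finite) tensor"
  shows "assoc_poly T (c *s x) = c ^ CARD('d) * assoc_poly T x"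
  by (simp add: assoc_poly_def prod.distrib sum_distrib_left mult_ac)

lemma assoc_poly_tensor_act:
  fixes T :: "('d::finite, 'n::finite) tensor"
  shows "assoc_poly (tensor_act A T) x = assoc_poly T (transpose A *v x)"
proof -
  have expand: "(\<Prod>k\<in>UNIV. (transpose A *v x) $ i k) = (\<Sum>m\<in>UNIV. \<Prod>k\<in>UNIV. A $ m k $ i k * x $ m k)"
    for i :: "'d \<Rightarrow> 'n"
  proof -
    have "(\<Prod>k\<in>UNIV. (transpose A *v x) $ i k) = (\<Prod>k\<in>UNIV. \<Sum>b\<in>UNIV. A $ b $ i k * x $ b)"
      by (simp add: matrix_vector_mult_def transpose_def)
    also have "\<dots> = (\<Sum>m\<in>PiE UNIV (\<lambda>_. UNIV). \<Prod>k\<in>UNIV. A $ m k $ i k * x $ m k)"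
      by (rule prod_sum_PiE) auto
    finally show ?thesis by simp
  qed
  have column: "(A *v axis a 1) $ b = A $ b $ a" for a b
    by (simp add: matrix_vector_mult_def axis_def if_distrib cong: if_cong)
  have "assoc_poly (tensor_act A T) x =
      (\<Sum>m\<in>UNIV. \<Sum>i\<in>UNIV. T $ i * (\<Prod>k\<in>UNIV. A $ m k $ i k * x $ m k))"
    by (simp add: assoc_poly_def tensor_act_def pure_tensor_def column
        sum_distrib_right prod.distrib mult.assoc)
  also have "\<dots> = (\<Sum>i\<in>UNIV. T $ i * (\<Sum>m\<in>UNIV. \<Prod>k\<in>UNIV. A $ m k $ i k * x $ m k))"
    by (subst sum.swap) (simp add: sum_distrib_left)
  also have "\<dots> = assoc_poly T (transpose A *v x)" unfolding assoc_poly_def expand ..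
  finally show ?thesis .
qed

lemma sing_locus_closed: "zariski_closed (sing_locus T)"
proof -
  have "sing_locus T = (\<Inter>j. {x. partial_deriv j (assoc_poly T) x = 0})" by (auto simp: sing_locus_def)
  then show ?thesis
    by (auto intro!: zariski_closed_Inter zariski_closed_zeros
        partial_deriv_polynomial(1)[OF polynomial_fun_assoc_poly])
qed

text \<open>
  In terms of all directional derivatives the singular locus does not depend on the coordinates, which
  makes its behaviour under linear substitutions visible.
\<close>

lemma sing_locus_iff:
  "x \<in> sing_locus T \<longleftrightarrow> (\<forall>v. ((\<lambda>z. assoc_poly T (x + z *s v)) has_field_derivative 0) (at 0))"
proof
  assume "x \<in> sing_locus T"
  then show "\<forall>v. ((\<lambda>z. assoc_poly T (x + z *s v)) has_field_derivative 0) (at 0)"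
    using partial_deriv_polynomial(2)[OF polynomial_fun_assoc_poly, of T x] by (simp add: sing_locus_def)
next
  assume D: "\<forall>v. ((\<lambda>z. assoc_poly T (x + z *s v)) has_field_derivative 0) (at 0)"
  have "((\<lambda>z. assoc_poly T (x + axis j z)) has_field_derivative 0) (at 0)" for j
    using D[rule_format, of "axis j 1"] by (simp add: axis_eq_scale[symmetric])
  then have "partial_deriv j (assoc_poly T) x = 0" for j
    unfolding partial_deriv_def by (rule DERIV_imp_deriv)
  then show "x \<in> sing_locus T" by (simp add: sing_locus_def)
qed

text \<open>
  Scaling the point and the direction together multiplies the form by a power of the scalar. For the
  origin to be singular the degree has to be at least two.
\<close>

lemma sing_locus_cone:
  fixes T :: "('d::finite, 'n::finite) tensor"
  assumes "CARD('d) \<ge> 2"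
  shows "complex_cone (sing_locus T)"
proof -
  have zero: "0 \<in> sing_locus T"
    unfolding sing_locus_iff
  proof
    fix v
    have "((\<lambda>z. z ^ CARD('d) * assoc_poly T v) has_field_derivative 0) (at 0)"
      using assms by (auto intro!: derivative_eq_intros)
    then show "((\<lambda>z. assoc_poly T (0 + z *s v)) has_field_derivative 0) (at 0)"
      by (simp add: assoc_poly_scale)
  qed
  have "c *s x \<in> sing_locus T" if x: "x \<in> sing_locus T" for c x
  proof (cases "c = 0")
    case False
    show ?thesis
      unfolding sing_locus_iff
    proof
      fix v
      have "assoc_poly T (c *s x + z *s v) = c ^ CARD('d) * assoc_poly T (x + z *s (inverse c *s v))" for z
      proof -
        have "c *s x + z *s v = c *s (x + z *s (inverse c *s v))" using False by (vector field_simps)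
        then show ?thesis by (simp only: assoc_poly_scale)
      qed
      moreover have "((\<lambda>z. c ^ CARD('d) * assoc_poly T (x + z *s (inverse c *s v))) has_field_derivative
          c ^ CARD('d) * 0) (at 0)"
        using x unfolding sing_locus_iff by (intro DERIV_cmult) blast
      ultimately show "((\<lambda>z. assoc_poly T (c *s x + z *s v)) has_field_derivative 0) (at 0)" by simp
    qed
  qed (use zero in simp)
  with zero show ?thesis by (simp add: complex_cone_def)
qed

text \<open>
  By the chain rule, the derivative of \<open>F (B x)\<close> in direction \<open>v\<close> is the derivative of \<open>F\<close> at \<open>B x\<close> in
  direction \<open>B v\<close>.
\<close>

lemma sing_locus_tensor_act: "(*v) (transpose A) -` sing_locus T \<subseteq> sing_locus (tensor_act A T)"
proof
  fix x assume "x \<in> (*v) (transpose A) -` sing_locus T"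
  then have "((\<lambda>z. assoc_poly T (transpose A *v x + z *s (transpose A *v v))) has_field_derivative 0) (at 0)" for v
    by (simp add: sing_locus_iff del: transpose_matrix_vector)
  then show "x \<in> sing_locus (tensor_act A T)"
    by (simp add: sing_locus_iff assoc_poly_tensor_act matrix_vector_right_distrib vec.scale
        del: transpose_matrix_vector)
qed

lemma krull_dim_mono: "X \<subseteq> Y \<Longrightarrow> krull_dim X \<le> krull_dim Y"
  unfolding krull_dim_def by (rule Sup_subset_mono) blast

text \<open>
  Let \<open>L\<close> be a subspace that meets the preimage only in the origin and has the dimension which
  realizes the bound for the preimage. The kernel of \<open>B\<close> lies in the preimage, as \<open>X\<close> contains the
  origin; so \<open>B\<close> is injective on \<open>L\<close>, and the image of \<open>L\<close> is a subspace of the same dimension that meets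
  \<open>X\<close> only in the origin.
\<close>

lemma krull_dim_cone_vimage:
  fixes B :: "complex ^ 'n::finite ^ 'n"
  assumes X: "zariski_closed X" "complex_cone X"
  shows "krull_dim X \<le> krull_dim ((*v) B -` X)"
proof -
  have "polynomial_fun (\<lambda>x. (B *v x) $ i)" for i
    by (simp add: matrix_vector_mult_def polynomial_fun_sum polynomial_fun.intros)
  then have "zariski_closed ((*v) B -` X)" by (rule zariski_closed_vimage[OF X(1)])
  moreover have "complex_cone ((*v) B -` X)"
    using X(2) by (simp add: complex_cone_def vec.scale)
  ultimately obtain L where L: "vec.subspace L" "(*v) B -` X \<inter> L \<subseteq> {0}"
    "enat (CARD('n) - vec.dim L) \<le> krull_dim ((*v) B -` X)"
    using exists_complement_krull_dim_ge by blast
  have "inj_on ((*v) B) L"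
  proof (rule inj_onI)
    fix x y assume xy: "x \<in> L" "y \<in> L" "B *v x = B *v y"
    then have "B *v (x - y) = 0" by (simp add: matrix_vector_mult_diff_distrib)
    then have "x - y \<in> (*v) B -` X \<inter> L"
      using X(2) xy vec.subspace_diff[OF L(1)] by (simp add: complex_cone_def)
    then show "x = y" using L(2) by auto
  qed
  then have "vec.dim ((*v) B ` L) = vec.dim L"
    using L(1) by (intro vec.dim_image_eq) (auto simp: vec.span_eq_iff[THEN iffD2])
  moreover have "X \<inter> (*v) B ` L \<subseteq> {0}" using L(2) by auto
  moreover have "vec.subspace ((*v) B ` L)" by (rule vec.subspace_image[OF L(1)])
  ultimately have "krull_dim X \<le> enat (CARD('n) - vec.dim L)"
    using krull_dim_le_codim[OF X, of "(*v) B ` L"] by simp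
  with L(3) show ?thesis by simp
qed

theorem lemma3p1:
  fixes S T :: "('d::finite, 'n::finite) tensor"
  assumes "CARD('d) \<ge> 2"
    and "S \<in> symmetric_tensors" and "T \<in> symmetric_tensors"
    and "S \<preceq> T"
  shows "sgr S \<le> sgr T"
proof -
  obtain A where A: "S = tensor_act A T" using assms(4) by (auto simp: tensor_le_def)
  have "krull_dim (sing_locus T) \<le> krull_dim ((*v) (transpose A) -` sing_locus T)"
    by (rule krull_dim_cone_vimage[OF sing_locus_closed sing_locus_cone[OF assms(1)]])
  also have "\<dots> \<le> krull_dim (sing_locus S)"
    unfolding A by (rule krull_dim_mono[OF sing_locus_tensor_act])
  finally have "krull_dim (sing_locus T) \<le> krull_dim (sing_locus S)" .
  then show ?thesis
    unfolding sgr_def codim_def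
    by (cases "krull_dim (sing_locus T)"; cases "krull_dim (sing_locus S)") auto
qed

end
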